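(* Let $n\ge 1$ and let $\xi=(\xi_i)_{1\le i\le n}$ be an exchangeable random vector with $\kappa=\mathbb{E}[|\xi_1|]<+\infty$ and $\sum_{i=1}^n\xi_i=0$ almost surely. Let $(E,\mathcal{B})$ be a measurable space and let $\mathcal{T}$ be a (non-empty) set of measurable functions from $E$ to $[-1,1]$. Define $\overline{g}$ on $E^n$ by $$\overline{g}((x_i)_{1\le i\le n})=\mathbb{E}\left[\sup_{t\in\mathcal{T}}\sum_{i=1}^n\xi_i t(x_i)\right],$$ the expectation being over $\xi$. If $X=(X_i)_{1\le i\le n}$ is a collection of $n$ independent random variables valued in $E$ such that $\overline{g}(X)$ is measurable, then for any $x>0$, $$\overline{g}(X)\le \mathbb{E}[\overline{g}(X)]+\sqrt{12\kappa x\,\mathbb{E}[\overline{g}(X)]}+5\kappa x$$ with probability at least $1-e^{-x}$. Moreover, for any $x>0$, $$\overline{g}(X)\ge \mathbb{E}[\overline{g}(X)]-\sqrt{12\kappa x\,\mathbb{E}[\overline{g}(X)]}$$ with probability at least $1-e^{-x}$.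
   Context: A random vector $(\xi_1,\dots,\xi_n)$ is exchangeable if $(\xi_{\pi(1)},\dots,\xi_{\pi(n)})$ has the same law as $\xi$ for every permutation $\pi$ of $\{1,\dots,n\}$.
   Formalization: Besides measurability of ḡ(X), the formal theorem assumes that ḡ is measurable on E^n up to null sets of the law of X; with measurability of ḡ(X) alone the claim fails on some pathological sample spaces. *)

theory Defs
  imports "HOL-Probability.Probability"
begin

definition joint_law ::
  "'a measure \<Rightarrow> 'b measure \<Rightarrow> nat \<Rightarrow> (nat \<Rightarrow> 'a \<Rightarrow> 'b) \<Rightarrow> (nat \<Rightarrow> 'b) measure"
  where "joint_law M E n X =
    distr M (Pi\<^sub>M {1..n} (\<lambda>_. E)) (\<lambda>\<omega>. \<lambda>i\<in>{1..n}. X i \<omega>)"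

definition exchangeable :: "'a measure \<Rightarrow> nat \<Rightarrow> (nat \<Rightarrow> 'a \<Rightarrow> real) \<Rightarrow> bool"
  where "exchangeable N n \<xi> \<longleftrightarrow>
    (\<forall>\<pi>. \<pi> permutes {1..n} \<longrightarrow>
      joint_law N borel n (\<lambda>i. \<xi> (\<pi> i)) = joint_law N borel n \<xi>)"

(* The expectation runs over the space N of the weights \<xi> only; x is a deterministic point
   of E^n.  For x in E^n and T a non-empty set of functions with values in [-1,1] on E, the
   supremum is over a non-empty bounded set, and it is a Lipschitz, hence Borel, function of
   the vector of weights even if T is uncountable; it is therefore integrable as soon as the
   weights are.

   As a function of x, however, gbar need not be measurable, and measurability of the
   composition with (X_i) on an arbitrary sample space does not give concentration.  Take
   E = [0,1] with its Borel sets, \<xi> a uniformly random balanced vector of signs (n even),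
   and T the indicators of the finite subsets of a set B such that B and its complement C both
   have full outer measure.  If the x_i are distinct, gbar is half the number of x_i in B.
   Let the sample space consist of the x in [0,1]^n with distinct coordinates such that
   either x_1 < 1/2 and all x_i lie in B, or x_1 >= 1/2 and all x_i lie in C, with the trace
   of the Borel sets and of Lebesgue measure.  The coordinates X_i are independent and uniform,
   yet gbar of them is n/2 if X_1 < 1/2 and 0 otherwise.  "gbar(X) is measurable" is therefore
   to be read as including measurability of gbar on E^n, for which it is enough to have it up
   to null sets of the joint law (completion (joint_law M E n X)); on the product sample space
   E^n, completed, this is the same as measurability of the composition. *)
definition gbar ::
  "'w measure \<Rightarrow> nat \<Rightarrow> (nat \<Rightarrow> 'w \<Rightarrow> real) \<Rightarrow> ('e \<Rightarrow> real) set \<Rightarrow> (nat \<Rightarrow> 'e) \<Rightarrow> real"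
  where "gbar N n \<xi> T x =
    (\<integral>\<omega>. (SUP t\<in>T. \<Sum>i=1..n. \<xi> i \<omega> * t (x i)) \<partial>N)"

end

theory Submission
  imports Defs
begin

text \<open>
  Replacing \<open>\<xi>\<close> by its average over the exchanges of the entries \<open>i\<close> and \<open>k\<close>, for \<open>k = 1, \<dots>, n\<close>, gives
  weights whose entry \<open>i\<close> is \<open>0\<close>, because the \<open>\<xi> k\<close> add up to \<open>0\<close>. The expected supremum \<open>g i\<close> for
  these weights does not depend on \<open>x i\<close>; by convexity and exchangeability \<open>g i \<le> gbar \<le> g i + 3\<kappa>\<close>, and
  evaluating at an almost optimal \<open>t\<close> shows that the sum of \<open>gbar - g i\<close> over \<open>i\<close> is at most \<open>2 gbar\<close>.
  Thus \<open>gbar / (3\<kappa>)\<close> is a self-bounding function with parameters \<open>(2, 0)\<close> in the sense of Boucheron,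
  Lugosi and Massart. Tensorization of the entropy then yields a differential inequality for the
  logarithm of its Laplace transform, which is integrated separately for positive and for negative
  arguments, and Chernoff's bound gives the two tails.
\<close>

section \<open>Tensorization of the entropy\<close>

text \<open>Setting the entry i of \<open>\<xi>\<close> to 0 would spoil the zero sum, and the
  result would not be an average of permuted weights, so Jensen's inequality would give no
  comparison with \<open>gbar\<close>. Averaging over the exchanges removes entry i while staying in
  the convex hull of the permutations. Measurability shapes the rest. \<open>gbar\<close> is
  measurable only up to null sets, and nothing of the kind is known for the \<open>g i\<close>. The
  entropy argument therefore runs on a bounded Borel modification of
  \<open>gbar / (3\<kappa>)\<close>, and the self-bounding inequalities hold almost everywhere. The
  two signs of the Laplace parameter differ because \<open>phi (- l)\<close> is at most l^2 / 2 only
  for l \<ge> 0. For l < 0 the bound degrades by a factor 1 / (1 - |l| / 3), which the lower tail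
  absorbs when the self-bounding parameter a is at least 1/3; here a = 2. Constants: if v is the
  mean of \<open>gbar / (3\<kappa>)\<close>, its upper deviation is sqrt(4 v x) + x. Multiplied by
  3\<kappa>, this is sqrt(12 \<kappa> x \<mu>) + 3 \<kappa> x, with \<mu> = 3 \<kappa> v, and 3
  \<le> 5.\<close>

lemma bounded_integrable:
  fixes f :: "'a \<Rightarrow> real"
  assumes "prob_space M" "f \<in> borel_measurable M" "\<And>x. x \<in> space M \<Longrightarrow> \<bar>f x\<bar> \<le> B"
  shows "integrable M f"
proof -
  interpret prob_space M by fact
  show ?thesis by (rule integrable_const_bound[where B = B]) (use assms in auto)
qed

text \<open>If f is not integrable its integral is 0 by convention, and B \<ge> 0 because it bounds
  an absolute value.\<close>

lemma abs_integral_le: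
  fixes f :: "'a \<Rightarrow> real"
  assumes "prob_space M" "\<And>x. \<bar>f x\<bar> \<le> B"
  shows "\<bar>\<integral>x. f x \<partial>M\<bar> \<le> B"
proof (cases "integrable M f")
  case True
  interpret prob_space M by fact
  have "\<bar>\<integral>x. f x \<partial>M\<bar> \<le> (\<integral>x. \<bar>f x\<bar> \<partial>M)" by simp
  also have "\<dots> \<le> B" using True assms(2) by (intro integral_le_const) auto
  finally show ?thesis .
next
  case False
  then show ?thesis using assms(2)[of undefined] by (simp add: not_integrable_integral_eq)
qed

lemma integral_between:
  fixes f :: "'a \<Rightarrow> real"
  assumes "prob_space M" "f \<in> borel_measurable M"
    and "\<And>x. x \<in> space M \<Longrightarrow> m \<le> f x" "\<And>x. x \<in> space M \<Longrightarrow> f x \<le> B"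
  shows "m \<le> (\<integral>x. f x \<partial>M)" "(\<integral>x. f x \<partial>M) \<le> B"
proof -
  interpret prob_space M by fact
  have "\<bar>f x\<bar> \<le> max \<bar>m\<bar> \<bar>B\<bar>" if "x \<in> space M" for x
    using assms(3)[OF that] assms(4)[OF that] by linarith
  then have "integrable M f"
    using assms(1,2) by (intro bounded_integrable)
  then show "m \<le> (\<integral>x. f x \<partial>M)" "(\<integral>x. f x \<partial>M) \<le> B"
    using assms(3,4) by (auto intro: integral_le_const integral_ge_const)
qed

lemma abs_ln_le:
  fixes y :: real
  assumes "0 < m" "m \<le> y" "y \<le> B"
  shows "\<bar>ln y\<bar> \<le> max \<bar>ln m\<bar> \<bar>ln B\<bar>"
proof -
  have "ln m \<le> ln y" "ln y \<le> ln B" using assms by auto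
  then show ?thesis by linarith
qed

section \<open>Entropy of a positive function and its variational formulas\<close>

definition fun_entropy :: "'a measure \<Rightarrow> ('a \<Rightarrow> real) \<Rightarrow> real" where
  "fun_entropy M Y = (\<integral>x. Y x * ln (Y x) \<partial>M) - (\<integral>x. Y x \<partial>M) * ln (\<integral>x. Y x \<partial>M)"

lemma abs_fun_entropy_le:
  assumes "prob_space M" "Y \<in> borel_measurable M" "0 < m" "\<And>x. m \<le> Y x" "\<And>x. Y x \<le> B"
  shows "\<bar>fun_entropy M Y\<bar> \<le> 2 * (B * max \<bar>ln m\<bar> \<bar>ln B\<bar>)"
proof -
  let ?c = "max \<bar>ln m\<bar> \<bar>ln B\<bar>"
  have *: "\<bar>y * ln y\<bar> \<le> B * ?c" if "m \<le> y" "y \<le> B" for y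
    unfolding abs_mult using abs_ln_le[OF assms(3) that] that assms(3) by (intro mult_mono) auto
  have "\<bar>\<integral>x. Y x * ln (Y x) \<partial>M\<bar> \<le> B * ?c"
    using assms by (intro abs_integral_le *) auto
  moreover have "\<bar>(\<integral>x. Y x \<partial>M) * ln (\<integral>x. Y x \<partial>M)\<bar> \<le> B * ?c"
    using integral_between[OF assms(1,2,4,5)] by (intro *) auto
  ultimately show ?thesis unfolding fun_entropy_def by linarith
qed

text \<open>This is ln z \<le> z - 1 at z = b / E[Y], with equality for b = E[Y]. The free b is
  later taken as the value of exp(l f) at a point that ignores one coordinate.\<close>

lemma fun_entropy_le:
  assumes "prob_space M" "Y \<in> borel_measurable M" "0 < m" "\<And>x. m \<le> Y x" "\<And>x. Y x \<le> B" "0 < b"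
  shows "fun_entropy M Y \<le> (\<integral>x. Y x * ln (Y x) - Y x * ln b - Y x + b \<partial>M)"
proof -
  interpret prob_space M by fact
  let ?y = "\<integral>x. Y x \<partial>M"
  note [measurable] = assms(2)
  have Yb: "\<bar>Y x\<bar> \<le> B" for x using assms(3) assms(4)[of x] assms(5)[of x] by linarith
  have "0 \<le> B" using Yb[of undefined] by linarith
  have "\<bar>Y x * ln (Y x)\<bar> \<le> B * max \<bar>ln m\<bar> \<bar>ln B\<bar>" for x
    unfolding abs_mult using abs_ln_le[OF assms(3-5)] Yb \<open>0 \<le> B\<close> by (intro mult_mono) auto
  then have i: "integrable M (\<lambda>x. Y x * ln (Y x))" "integrable M Y"
    using Yb by (auto intro!: bounded_integrable assms(1))
  have y: "?y > 0" using integral_between(1)[OF assms(1,2,4,5)] assms(3) by linarith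
  have "ln (b / ?y) \<le> b / ?y - 1"
    using ln_le_minus_one[of "b / ?y"] y assms(6) by auto
  then have "?y * ln (b / ?y) \<le> ?y * (b / ?y - 1)" using y by (intro mult_left_mono) auto
  then have "?y * ln b - ?y * ln ?y \<le> b - ?y"
    using y assms(6) by (simp add: ln_div algebra_simps)
  moreover have "(\<integral>x. Y x * ln (Y x) - Y x * ln b - Y x + b \<partial>M) =
     (\<integral>x. Y x * ln (Y x) \<partial>M) - ?y * ln b - ?y + b"
    using i by (simp add: prob_space)
  ultimately show ?thesis unfolding fun_entropy_def by linarith
qed

text \<open>One half of the duality formula for entropy: apply ln z \<le> z - 1 at z = E[Y] U / Y
  and multiply by Y; then Y - E[Y] U integrates to 0. U is bounded on the space only, since it will
  be a normalized partial integral.\<close>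

lemma fun_entropy_ge:
  assumes "prob_space M" "Y \<in> borel_measurable M" "0 < m" "\<And>x. m \<le> Y x" "\<And>x. Y x \<le> B"
    and "U \<in> borel_measurable M" "0 < l" "\<And>x. x \<in> space M \<Longrightarrow> l \<le> U x" "\<And>x. x \<in> space M \<Longrightarrow> U x \<le> D" "(\<integral>x. U x \<partial>M) = 1"
  shows "(\<integral>x. Y x * ln (U x) \<partial>M) \<le> fun_entropy M Y"
proof -
  interpret prob_space M by fact
  let ?y = "\<integral>x. Y x \<partial>M"
  note [measurable] = assms(2,6)
  have Yb: "\<bar>Y x\<bar> \<le> B" for x using assms(3) assms(4)[of x] assms(5)[of x] by linarith
  have Ub: "\<bar>U x\<bar> \<le> D" if "x \<in> space M" for x using that assms(7) assms(8)[of x] assms(9)[of x] by linarith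
  have "0 \<le> B" using Yb[of undefined] by linarith
  have "\<bar>Y x * ln (Y x)\<bar> \<le> B * max \<bar>ln m\<bar> \<bar>ln B\<bar>" for x
    unfolding abs_mult using abs_ln_le[OF assms(3-5)] Yb \<open>0 \<le> B\<close> by (intro mult_mono) auto
  moreover have "\<bar>Y x * ln (U x)\<bar> \<le> B * max \<bar>ln l\<bar> \<bar>ln D\<bar>" if "x \<in> space M" for x
    unfolding abs_mult using abs_ln_le[OF assms(7) assms(8,9)[OF that]] Yb \<open>0 \<le> B\<close> by (intro mult_mono) auto
  ultimately have i: "integrable M (\<lambda>x. Y x * ln (Y x))" "integrable M Y"
      "integrable M (\<lambda>x. Y x * ln (U x))" "integrable M U"
    using Yb Ub by (auto intro!: bounded_integrable assms(1))
  have y: "?y > 0" using integral_between(1)[OF assms(1,2,4,5)] assms(3) by linarith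
  have "0 = (\<integral>x. Y x - ?y * U x \<partial>M)" using i assms(10) by simp
  also have "\<dots> \<le> (\<integral>x. Y x * ln (Y x) - Y x * ln (U x) - Y x * ln ?y \<partial>M)"
  proof (rule integral_mono)
    fix x assume x: "x \<in> space M"
    have p: "Y x > 0" "U x > 0" using assms(3,7) assms(4)[of x] assms(8)[OF x] by linarith+
    have "ln (?y * U x / Y x) \<le> ?y * U x / Y x - 1"
      using ln_le_minus_one[of "?y * U x / Y x"] y p by auto
    then have "Y x * ln (?y * U x / Y x) \<le> Y x * (?y * U x / Y x - 1)" using p by (intro mult_left_mono) auto
    then show "Y x - ?y * U x \<le> Y x * ln (Y x) - Y x * ln (U x) - Y x * ln ?y"
      using y p by (simp add: ln_div ln_mult algebra_simps)
  qed (use i in auto)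
  also have "\<dots> = (\<integral>x. Y x * ln (Y x) \<partial>M) - (\<integral>x. Y x * ln (U x) \<partial>M) - ?y * ln ?y"
    using i by simp
  finally show ?thesis unfolding fun_entropy_def by linarith
qed

text \<open>With W the partial mean over A, the averaged entropy over A leaves exactly the entropy
  of W over B. That entropy is the integral of Y ln(W / w); after exchanging the integrals, duality
  with U = W / w bounds it for each fixed a by the entropy of Y(a, .).\<close>

lemma fun_entropy_pair:
  fixes Y :: "'a \<times> 'b \<Rightarrow> real"
  assumes "prob_space A" "prob_space B" and Y[measurable]: "Y \<in> borel_measurable (A \<Otimes>\<^sub>M B)"
    and m: "0 < m" "\<And>z. m \<le> Y z" "\<And>z. Y z \<le> D"
  shows "fun_entropy (A \<Otimes>\<^sub>M B) Y \<le> (\<integral>b. fun_entropy A (\<lambda>a. Y (a, b)) \<partial>B) + (\<integral>a. fun_entropy B (\<lambda>b. Y (a, b)) \<partial>A)"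
proof -
  interpret A: prob_space A by fact
  interpret B: prob_space B by fact
  interpret P: pair_prob_space A B ..
  define W where "W b = (\<integral>a. Y (a, b) \<partial>A)" for b
  define w where "w = (\<integral>b. W b \<partial>B)"
  have W[measurable]: "W \<in> borel_measurable B" unfolding W_def by measurable
  have Wb: "W b \<le> D" if "b \<in> space B" for b
    unfolding W_def using that by (intro integral_between(2)[OF assms(1) _ m(2)] m) measurable
  have Wm: "m \<le> W b" if "b \<in> space B" for b
    unfolding W_def using that by (intro integral_between(1)[OF assms(1) _ _ m(3)] m) measurable
  have Db: "\<bar>Y z\<bar> \<le> D" for z using m(1) m(2)[of z] m(3)[of z] by linarith
  have D: "0 < D" using m(1) m(2)[of undefined] m(3)[of undefined] by linarith
  have w: "m \<le> w" "w \<le> D" unfolding w_def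
    by (rule integral_between[OF assms(2) W]; use Wb Wm in blast)+
  have w0: "0 < w" using w(1) m(1) by linarith
  have W0: "0 < W b" if "b \<in> space B" for b using Wm[OF that] m(1) by linarith
  have AB: "prob_space (A \<Otimes>\<^sub>M B)" by (rule prob_space_pair) fact+
  define C where "C = D * max \<bar>ln m\<bar> \<bar>ln D\<bar>"
  have lnb: "\<bar>y * ln y\<bar> \<le> C" if "m \<le> y" "y \<le> D" for y
    unfolding C_def abs_mult using abs_ln_le[OF m(1) that] that m(1) by (intro mult_mono) auto
  have U: "m / w \<le> W b / w" "W b / w \<le> D / w" if "b \<in> space B" for b
    using Wb[OF that] Wm[OF that] w0 by (auto intro!: divide_right_mono)
  have Uln: "\<bar>ln (W b / w)\<bar> \<le> max \<bar>ln (m / w)\<bar> \<bar>ln (D / w)\<bar>" if "b \<in> space B" for b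
    using U[OF that] m(1) w0 by (intro abs_ln_le) auto
  have iY: "integrable (A \<Otimes>\<^sub>M B) Y"
    by (rule bounded_integrable[OF AB Y Db])
  have iYY: "integrable (A \<Otimes>\<^sub>M B) (\<lambda>z. Y z * ln (Y z))"
    by (rule bounded_integrable[OF AB, of _ C]) (use lnb m in auto)
  have iYU: "integrable (A \<Otimes>\<^sub>M B) (\<lambda>(a, b). Y (a, b) * ln (W b / w))"
  proof (rule bounded_integrable[OF AB])
    fix z assume "z \<in> space (A \<Otimes>\<^sub>M B)"
    then show "\<bar>case z of (a, b) \<Rightarrow> Y (a, b) * ln (W b / w)\<bar> \<le> D * max \<bar>ln (m / w)\<bar> \<bar>ln (D / w)\<bar>"
      using Db Uln D by (auto simp: abs_mult space_pair_measure intro!: mult_mono)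
  qed simp
  have iW: "integrable B W"
    by (rule bounded_integrable[OF assms(2) W, of D]) (use Wb W0 in fastforce)
  have iWW: "integrable B (\<lambda>b. W b * ln (W b))"
    by (rule bounded_integrable[OF assms(2), of _ C]) (use lnb Wm Wb in auto)
  have "(\<integral>b. fun_entropy A (\<lambda>a. Y (a, b)) \<partial>B) =
      (\<integral>b. (\<integral>a. Y (a, b) * ln (Y (a, b)) \<partial>A) \<partial>B) - (\<integral>b. W b * ln (W b) \<partial>B)"
    unfolding fun_entropy_def W_def[symmetric] using P.integrable_snd[of "\<lambda>a b. Y (a, b) * ln (Y (a, b))"] iYY iWW
    by (intro Bochner_Integration.integral_diff) (auto simp: case_prod_beta')
  also have "(\<integral>b. (\<integral>a. Y (a, b) * ln (Y (a, b)) \<partial>A) \<partial>B) = (\<integral>z. Y z * ln (Y z) \<partial>(A \<Otimes>\<^sub>M B))"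
    using P.integral_snd[of "\<lambda>a b. Y (a, b) * ln (Y (a, b))"] iYY by (auto simp: case_prod_beta')
  finally have 1: "(\<integral>b. fun_entropy A (\<lambda>a. Y (a, b)) \<partial>B) =
    (\<integral>z. Y z * ln (Y z) \<partial>(A \<Otimes>\<^sub>M B)) - (\<integral>b. W b * ln (W b) \<partial>B)" .
  have wY: "(\<integral>z. Y z \<partial>(A \<Otimes>\<^sub>M B)) = w"
    unfolding w_def W_def using P.integral_snd[of "\<lambda>a b. Y (a, b)"] iY by (auto simp: case_prod_beta')
  have "(\<integral>b. W b * ln (W b) \<partial>B) - w * ln w = (\<integral>b. W b * ln (W b) - W b * ln w \<partial>B)"
    using iW iWW by (simp add: w_def)
  also have "\<dots> = (\<integral>b. (\<integral>a. Y (a, b) * ln (W b / w) \<partial>A) \<partial>B)"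
    using W0 w0 by (intro Bochner_Integration.integral_cong) (auto simp: W_def[symmetric] ln_div algebra_simps)
  also have "\<dots> = (\<integral>a. (\<integral>b. Y (a, b) * ln (W b / w) \<partial>B) \<partial>A)"
    using iYU by (intro P.Fubini_integral) auto
  also have "\<dots> \<le> (\<integral>a. fun_entropy B (\<lambda>b. Y (a, b)) \<partial>A)"
  proof (rule integral_mono)
    show "integrable A (\<lambda>a. \<integral>b. Y (a, b) * ln (W b / w) \<partial>B)"
      using P.integrable_fst[OF iYU] by simp
    show "integrable A (\<lambda>a. fun_entropy B (\<lambda>b. Y (a, b)))"
    proof (rule bounded_integrable[OF assms(1)])
      show "(\<lambda>a. fun_entropy B (\<lambda>b. Y (a, b))) \<in> borel_measurable A" unfolding fun_entropy_def by measurable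
      show "\<bar>fun_entropy B (\<lambda>b. Y (a, b))\<bar> \<le> 2 * (D * max \<bar>ln m\<bar> \<bar>ln D\<bar>)" if "a \<in> space A" for a
        using that by (intro abs_fun_entropy_le assms(2) m) measurable
    qed
    fix a assume a: "a \<in> space A"
    then show "(\<integral>b. Y (a, b) * ln (W b / w) \<partial>B) \<le> fun_entropy B (\<lambda>b. Y (a, b))"
      using m(1) w0 U by (intro fun_entropy_ge[OF assms(2) _ m(1) m(2,3), where l = "m / w" and D = "D / w"])
        (auto simp: w_def[symmetric])
  qed
  finally show ?thesis using 1 unfolding fun_entropy_def[of "A \<Otimes>\<^sub>M B"] wY by linarith
qed

section \<open>Overwriting one coordinate of a product measure\<close>

lemma measurable_upd_PiM:
  assumes "insert j J = K"
  shows "(\<lambda>z. (snd z)(j := fst z)) \<in> P j \<Otimes>\<^sub>M PiM J P \<rightarrow>\<^sub>M PiM K P"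
  unfolding assms[symmetric] by measurable

text \<open>Whatever was at j is overwritten by a fresh independent value. So j may lie in J or not:
  J = K resamples a coordinate, while j outside J splits one off. Both cases are used.\<close>

lemma PiM_eq_distr_upd:
  assumes "insert j J = K" "\<And>i. i \<in> K \<Longrightarrow> prob_space (P i)"
  shows "PiM K P = distr (P j \<Otimes>\<^sub>M PiM J P) (PiM K P) (\<lambda>z. (snd z)(j := fst z))"
  using distr_pair_PiM_eq_PiM[of J P j] assms by (auto simp: case_prod_beta')

lemma integral_PiM_upd:
  fixes F :: "('i \<Rightarrow> 'a) \<Rightarrow> real"
  assumes K: "insert j J = K" "\<And>i. i \<in> K \<Longrightarrow> prob_space (P i)"
    and F: "F \<in> borel_measurable (PiM K P)" "\<And>x. x \<in> space (PiM K P) \<Longrightarrow> \<bar>F x\<bar> \<le> C"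
  shows "(\<integral>x. F x \<partial>PiM K P) = (\<integral>x. (\<integral>y. F (x(j := y)) \<partial>P j) \<partial>PiM J P)"
    "(\<integral>x. F x \<partial>PiM K P) = (\<integral>y. (\<integral>x. F (x(j := y)) \<partial>PiM J P) \<partial>P j)"
    "integrable (P j) (\<lambda>y. \<integral>x. F (x(j := y)) \<partial>PiM J P)"
proof -
  interpret A: prob_space "P j" using K by auto
  interpret B: prob_space "PiM J P" using K by (intro prob_space_PiM) auto
  interpret Q: pair_prob_space "P j" "PiM J P" ..
  note m = measurable_upd_PiM[OF K(1), of P]
  have i: "integrable (P j \<Otimes>\<^sub>M PiM J P) (\<lambda>(y, x). F (x(j := y)))"
    using F(2)[OF measurable_space[OF m]] measurable_compose[OF m F(1)]
    by (intro bounded_integrable[OF prob_space_pair, of _ _ _ C])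
       (auto simp: case_prod_beta' A.prob_space_axioms B.prob_space_axioms)
  have "(\<integral>x. F x \<partial>PiM K P) = (\<integral>z. F ((snd z)(j := fst z)) \<partial>(P j \<Otimes>\<^sub>M PiM J P))"
    by (subst PiM_eq_distr_upd[OF K]) (use m F in \<open>auto simp: integral_distr\<close>)
  then show "(\<integral>x. F x \<partial>PiM K P) = (\<integral>x. (\<integral>y. F (x(j := y)) \<partial>P j) \<partial>PiM J P)"
    "(\<integral>x. F x \<partial>PiM K P) = (\<integral>y. (\<integral>x. F (x(j := y)) \<partial>PiM J P) \<partial>P j)"
    "integrable (P j) (\<lambda>y. \<integral>x. F (x(j := y)) \<partial>PiM J P)"
    using Q.integral_snd[OF i] Q.integral_fst[OF i] Q.integrable_fst[OF i] by (auto simp: case_prod_beta')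
qed

text \<open>Resampling preserves the law, so Q holds almost everywhere for the pair (x, y); Fubini
  for null sets separates the two. Swapping the factors puts x outermost.\<close>

lemma AE_PiM_upd:
  assumes K: "j \<in> K" "\<And>i. i \<in> K \<Longrightarrow> prob_space (P i)"
    and "AE x in PiM K P. Q x"
  shows "AE x in PiM K P. AE y in P j. Q (x(j := y))"
proof -
  interpret A: prob_space "P j" using K by auto
  interpret B: prob_space "PiM K P" using K by (intro prob_space_PiM) auto
  interpret Q: pair_prob_space "P j" "PiM K P" ..
  interpret Q': pair_prob_space "PiM K P" "P j" ..
  have *: "insert j K = K" using K by auto
  have "AE x in distr (P j \<Otimes>\<^sub>M PiM K P) (PiM K P) (\<lambda>z. (snd z)(j := fst z)). Q x"
    by (subst PiM_eq_distr_upd[OF *, of P, symmetric]) (use K(2) assms(3) in auto)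
  from AE_distrD[OF measurable_upd_PiM[OF *] this]
  have "AE z in distr (PiM K P \<Otimes>\<^sub>M P j) (P j \<Otimes>\<^sub>M PiM K P) (\<lambda>(x, y). (y, x)). Q ((snd z)(j := fst z))"
    by (subst Q.distr_pair_swap[symmetric])
  from AE_distrD[OF measurable_pair_swap' this]
  have "AE z in PiM K P \<Otimes>\<^sub>M P j. Q ((fst z)(j := snd z))"
    by (simp add: case_prod_beta')
  from Q'.AE_pair[OF this] show ?thesis by simp
qed

lemma measurable_fun_entropy_upd:
  fixes Y :: "('i \<Rightarrow> 'a) \<Rightarrow> real"
  assumes K: "insert j J = K" "\<And>i. i \<in> K \<Longrightarrow> prob_space (P i)"
    and Y[measurable]: "Y \<in> borel_measurable (PiM K P)"
  shows "(\<lambda>x. fun_entropy (P j) (\<lambda>y. Y (x(j := y)))) \<in> borel_measurable (PiM J P)"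
proof -
  interpret A: prob_space "P j" using K by auto
  have [measurable]: "(\<lambda>(x, y). x(j := y)) \<in> PiM J P \<Otimes>\<^sub>M P j \<rightarrow>\<^sub>M PiM K P"
    using measurable_compose[OF measurable_pair_swap' measurable_upd_PiM[OF K(1), of P]]
    by (simp add: case_prod_beta')
  show ?thesis unfolding fun_entropy_def by measurable
qed

lemma fun_entropy_distr:
  fixes Y :: "'b \<Rightarrow> real"
  assumes "f \<in> M \<rightarrow>\<^sub>M N" "Y \<in> borel_measurable N"
  shows "fun_entropy (distr M N f) Y = fun_entropy M (\<lambda>x. Y (f x))"
  unfolding fun_entropy_def using assms by (simp add: integral_distr)

text \<open>Induction on the coordinates: \<open>fun_entropy_pair\<close> splits off coordinate i,
  and the induction hypothesis applies at each fixed value a of it. Every summand is integrated over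
  all of K although it ignores coordinate j, which gives all summands the same form.\<close>

lemma fun_entropy_PiM_le:
  fixes Y :: "('i \<Rightarrow> 'a) \<Rightarrow> real"
  assumes "finite K" "\<And>i. i \<in> K \<Longrightarrow> prob_space (P i)" "Y \<in> borel_measurable (PiM K P)"
    and m: "0 < m" "\<And>x. m \<le> Y x" "\<And>x. Y x \<le> D"
  shows "fun_entropy (PiM K P) Y \<le> (\<Sum>j\<in>K. \<integral>x. fun_entropy (P j) (\<lambda>y. Y (x(j := y))) \<partial>PiM K P)"
  using assms
proof (induction K arbitrary: Y rule: finite_induct)
  case empty
  then show ?case by (simp add: fun_entropy_def PiM_empty lebesgue_integral_count_space_finite)
next
  case (insert i I)
  note Y[measurable] = \<open>Y \<in> borel_measurable (Pi\<^sub>M (insert i I) P)\<close>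
  have P: "\<And>j. j \<in> insert i I \<Longrightarrow> prob_space (P j)" by fact
  interpret A: prob_space "P i" using P by auto
  interpret B: prob_space "PiM I P" using P by (intro prob_space_PiM) auto
  define C where "C = 2 * (D * max \<bar>ln m\<bar> \<bar>ln D\<bar>)"
  define F where "F j x = fun_entropy (P j) (\<lambda>y. Y (x(j := y)))" for j x
  let ?K = "insert i I"
  have Yu: "(\<lambda>y. Y (x(j := y))) \<in> borel_measurable (P j)"
    if "x \<in> space (PiM J P)" "insert j J = ?K" for x j J
    using measurable_compose[OF measurable_Pair2'[OF that(1)] measurable_compose[OF measurable_upd_PiM[OF that(2), of P] Y]]
    by simp
  have Fm: "F j \<in> borel_measurable (PiM ?K P)" if "j \<in> ?K" for j
    unfolding F_def using that by (intro measurable_fun_entropy_upd[OF _ P Y]) auto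
  have Fb: "\<bar>F j x\<bar> \<le> C" if "j \<in> ?K" "x \<in> space (PiM ?K P)" for j x
    unfolding F_def C_def using that by (intro abs_fun_entropy_le P Yu[of _ ?K] m insert.prems) auto
  have m': "(\<lambda>z. Y ((snd z)(i := fst z))) \<in> borel_measurable (P i \<Otimes>\<^sub>M PiM I P)"
    by (rule measurable_compose[OF measurable_upd_PiM[OF refl] Y])
  have Y2: "(\<lambda>x. Y (x(i := a))) \<in> borel_measurable (PiM I P)" if "a \<in> space (P i)" for a
    using measurable_compose[OF measurable_Pair1'[OF that] m'] by simp
  have iF: "integrable (P i) (\<lambda>a. \<integral>x. F j (x(i := a)) \<partial>PiM I P)" if "j \<in> I" for j
    using that by (intro integral_PiM_upd(3)[OF refl P Fm Fb]) auto
  have "fun_entropy (PiM ?K P) Y = fun_entropy (P i \<Otimes>\<^sub>M PiM I P) (\<lambda>z. Y ((snd z)(i := fst z)))"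
    by (subst PiM_eq_distr_upd[OF refl P], assumption, rule fun_entropy_distr) (use measurable_upd_PiM in auto)
  also have "\<dots> \<le> (\<integral>x. fun_entropy (P i) (\<lambda>a. Y (x(i := a))) \<partial>PiM I P) + (\<integral>a. fun_entropy (PiM I P) (\<lambda>x. Y (x(i := a))) \<partial>P i)"
    using fun_entropy_pair[OF A.prob_space_axioms B.prob_space_axioms m', of m D] insert.prems(3-5) by simp
  \<comment> \<open>\<open>F i\<close> ignores coordinate i, so integrating that coordinate against
    the probability \<open>P i\<close> changes nothing.\<close>
  also have "(\<integral>x. fun_entropy (P i) (\<lambda>a. Y (x(i := a))) \<partial>PiM I P) = (\<integral>x. F i x \<partial>PiM ?K P)"
    by (subst integral_PiM_upd(1)[OF refl P Fm Fb]) (auto simp: F_def A.prob_space)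
  also have "(\<integral>a. fun_entropy (PiM I P) (\<lambda>x. Y (x(i := a))) \<partial>P i) \<le> (\<integral>a. (\<Sum>j\<in>I. \<integral>x. F j (x(i := a)) \<partial>PiM I P) \<partial>P i)"
  proof (rule integral_mono)
    show "integrable (P i) (\<lambda>a. fun_entropy (PiM I P) (\<lambda>x. Y (x(i := a))))"
    proof (rule bounded_integrable[OF A.prob_space_axioms])
      have [measurable]: "(\<lambda>(a, x). Y (x(i := a))) \<in> borel_measurable (P i \<Otimes>\<^sub>M PiM I P)"
        using m' by (simp add: case_prod_beta')
      show "(\<lambda>a. fun_entropy (PiM I P) (\<lambda>x. Y (x(i := a)))) \<in> borel_measurable (P i)"
        unfolding fun_entropy_def by measurable
      show "\<bar>fun_entropy (PiM I P) (\<lambda>x. Y (x(i := a)))\<bar> \<le> C" if "a \<in> space (P i)" for a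
        unfolding C_def by (intro abs_fun_entropy_le B.prob_space_axioms Y2 that m insert.prems(4,5))
    qed
    show "integrable (P i) (\<lambda>a. \<Sum>j\<in>I. \<integral>x. F j (x(i := a)) \<partial>PiM I P)"
      using iF by auto
    fix a assume a: "a \<in> space (P i)"
    have "fun_entropy (PiM I P) (\<lambda>x. Y (x(i := a))) \<le> (\<Sum>j\<in>I. \<integral>x. fun_entropy (P j) (\<lambda>y. Y (x(j := y, i := a))) \<partial>PiM I P)"
      using insert.prems by (intro insert.IH Y2 a m) auto
    also have "\<dots> = (\<Sum>j\<in>I. \<integral>x. F j (x(i := a)) \<partial>PiM I P)"
    proof (intro sum.cong refl Bochner_Integration.integral_cong)
      fix j x assume "j \<in> I"
      then have "x(j := y, i := a) = x(i := a, j := y)" for y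
        using insert.hyps by (intro fun_upd_twist) auto
      then show "fun_entropy (P j) (\<lambda>y. Y (x(j := y, i := a))) = F j (x(i := a))" by (simp add: F_def)
    qed
    finally show "fun_entropy (PiM I P) (\<lambda>x. Y (x(i := a))) \<le> (\<Sum>j\<in>I. \<integral>x. F j (x(i := a)) \<partial>PiM I P)" .
  qed
  also have "\<dots> = (\<Sum>j\<in>I. \<integral>a. (\<integral>x. F j (x(i := a)) \<partial>PiM I P) \<partial>P i)"
    using iF by (intro Bochner_Integration.integral_sum)
  also have "\<dots> = (\<Sum>j\<in>I. \<integral>x. F j x \<partial>PiM ?K P)"
    using integral_PiM_upd(2)[OF refl P Fm Fb] by (intro sum.cong) auto
  finally show ?case unfolding F_def sum.insert[OF insert.hyps] by simp
qed

section \<open>Self-bounding functions\<close>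

definition phi :: "real \<Rightarrow> real" where "phi u = exp u - u - 1"

lemma phi_pos: "0 < phi u" if "u \<noteq> 0"
proof (cases "u > -2")
  case True
  \<comment> \<open>Squaring 1 + u/2 \<le> exp(u/2) leaves the strict surplus u^2 / 4. Squaring
    requires 1 + u/2 \<ge> 0, hence the case split.\<close>
  have "(1 + u/2)^2 \<le> (exp (u/2))^2"
    using exp_ge_add_one_self[of "u/2"] True by (intro power_mono) auto
  also have "\<dots> = exp u" by (simp add: power2_eq_square flip: exp_add)
  finally have "1 + u + u^2/4 \<le> exp u" by (simp add: power2_eq_square algebra_simps)
  moreover have "0 < u^2" using that by simp
  ultimately show ?thesis unfolding phi_def by linarith
next
  case False
  then show ?thesis using exp_gt_zero[of u] unfolding phi_def by linarith
qed

text \<open>Convexity of exp on the segment from 0 to u. It is used with s the increment of f over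
  \<open>g i\<close>, which is why increments must lie in [0,1].\<close>

lemma phi_mult_le:
  assumes "0 \<le> s" "s \<le> 1"
  shows "phi (s * u) \<le> s * phi u"
  using convex_onD[OF exp_convex assms, of 0 u] by (simp add: phi_def algebra_simps)

lemma phi_minus_le:
  assumes "0 \<le> u"
  shows "phi (- u) \<le> u^2 / 2"
proof -
  have "phi (- u) - u^2/2 \<le> phi (- 0) - 0^2/2"
  proof (rule DERIV_nonpos_imp_nonincreasing[OF assms])
    fix x :: real
    have "((\<lambda>u. phi (- u) - u^2/2) has_real_derivative (1 - x - exp (- x))) (at x)"
      unfolding phi_def by (auto intro!: derivative_eq_intros)
    then show "\<exists>y. DERIV (\<lambda>u. phi (- u) - u\<^sup>2 / 2) x :> y \<and> y \<le> 0"
      using exp_ge_add_one_self[of "-x"] by (intro exI conjI) auto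
  qed
  then show ?thesis by (simp add: phi_def)
qed

text \<open>The Bernstein bound on \<open>phi u\<close> by u^2 / 2 over 1 - u / 3, cleared of its
  denominator so that it holds for every u \<ge> 0.\<close>

lemma phi_mult_third_le:
  assumes "0 \<le> u"
  shows "phi u * (1 - u / 3) \<le> u^2 / 2"
proof -
  define r where "r u = u^2 / 2 - phi u * (1 - u / 3)" for u
  define r' where "r' u = u - (exp u - 1) * (1 - u / 3) + phi u / 3" for u
  have r: "(r has_real_derivative r' x) (at x)" for x
    unfolding r_def r'_def phi_def by (auto intro!: derivative_eq_intros simp: field_simps)
  have "r' 0 \<le> r' x" if "0 \<le> x" for x
  proof (rule DERIV_nonneg_imp_nondecreasing[OF that])
    fix y :: real
    have "(r' has_real_derivative (1 - exp y * (1 - y)) / 3) (at y)"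
      unfolding r'_def phi_def by (auto intro!: derivative_eq_intros simp: field_simps)
    moreover have "exp y * (1 - y) \<le> exp y * exp (- y)"
      using exp_ge_add_one_self[of "- y"] by (intro mult_left_mono) auto
    ultimately show "\<exists>d. DERIV r' y :> d \<and> 0 \<le> d"
      by (intro exI conjI) (auto simp: exp_minus)
  qed
  then have "r 0 \<le> r u"
    using r by (intro DERIV_nonneg_imp_nondecreasing[OF assms]) (auto simp: r'_def phi_def)
  then show ?thesis by (simp add: r_def phi_def)
qed

text \<open>For b = exp(l c) the integrand of \<open>fun_entropy_le\<close> equals exp(l u) phi(- l
  (u - c)), and \<open>phi_mult_le\<close> takes the factor u - c out of \<open>phi\<close>.\<close>

lemma fun_entropy_exp_le:
  assumes "prob_space M" and u: "u \<in> borel_measurable M" and C: "\<And>x. \<bar>u x\<bar> \<le> C"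
    and c: "AE x in M. c \<le> u x \<and> u x \<le> c + 1"
  shows "fun_entropy M (\<lambda>x. exp (l * u x)) \<le> phi (- l) * (\<integral>x. u x * exp (l * u x) \<partial>M - c * (\<integral>x. exp (l * u x) \<partial>M))"
proof -
  interpret prob_space M by fact
  note [measurable] = u
  define D where "D = \<bar>l\<bar> * C"
  have lu: "\<bar>l * u x\<bar> \<le> D" for x unfolding D_def abs_mult using C by (intro mult_left_mono) auto
  have e: "exp (- D) \<le> exp (l * u x)" "exp (l * u x) \<le> exp D" for x using lu[of x] by auto
  have i1: "integrable M (\<lambda>x. exp (l * u x))"
    by (rule bounded_integrable[OF assms(1), of _ "exp D"]) (use e in auto)
  have uexp: "\<bar>u x * exp (l * u x)\<bar> \<le> C * exp D" for x
    unfolding abs_mult using C[of x] e(2)[of x] by (intro mult_mono) auto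
  have i2: "integrable M (\<lambda>x. u x * exp (l * u x))"
    by (rule bounded_integrable[OF assms(1), of _ "C * exp D"]) (use uexp in auto)
  have "fun_entropy M (\<lambda>x. exp (l * u x)) \<le>
    (\<integral>x. exp (l * u x) * ln (exp (l * u x)) - exp (l * u x) * ln (exp (l * c)) - exp (l * u x) + exp (l * c) \<partial>M)"
    by (rule fun_entropy_le[OF assms(1) _ _ e]) auto
  also have "\<dots> \<le> (\<integral>x. phi (- l) * (u x * exp (l * u x) - c * exp (l * u x)) \<partial>M)"
  proof (rule integral_mono_AE)
    show "integrable M (\<lambda>x. exp (l * u x) * ln (exp (l * u x)) - exp (l * u x) * ln (exp (l * c)) - exp (l * u x) + exp (l * c))"
      using integrable_mult_right[OF i2, of l] i1 by (auto simp: mult_ac)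
    show "integrable M (\<lambda>x. phi (- l) * (u x * exp (l * u x) - c * exp (l * u x)))"
      using i1 i2 by auto
    show "AE x in M. exp (l * u x) * ln (exp (l * u x)) - exp (l * u x) * ln (exp (l * c)) - exp (l * u x) + exp (l * c)
        \<le> phi (- l) * (u x * exp (l * u x) - c * exp (l * u x))"
      using c
    proof eventually_elim
      case (elim x)
      have "exp (l * u x) * ln (exp (l * u x)) - exp (l * u x) * ln (exp (l * c)) - exp (l * u x) + exp (l * c)
        = exp (l * u x) * phi ((u x - c) * - l)"
        by (simp add: phi_def algebra_simps flip: exp_add)
      also have "\<dots> \<le> exp (l * u x) * ((u x - c) * phi (- l))"
        using elim by (intro mult_left_mono phi_mult_le) auto
      finally show ?case by (simp add: algebra_simps)
    qed
  qed
  also have "\<dots> = phi (- l) * (\<integral>x. u x * exp (l * u x) \<partial>M - c * (\<integral>x. exp (l * u x) \<partial>M))"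
    using i1 i2 by simp
  finally show ?thesis .
qed

text \<open>The increments are controlled almost everywhere because f will be a modification on a
  null set. In contrast, \<open>g i\<close> ignores coordinate i everywhere, so that it stays
  constant while that coordinate is resampled.\<close>

locale self_bounding =
  fixes K :: "'i set" and P :: "'i \<Rightarrow> 'a measure" and f :: "('i \<Rightarrow> 'a) \<Rightarrow> real"
    and g :: "'i \<Rightarrow> ('i \<Rightarrow> 'a) \<Rightarrow> real" and a C :: real
  assumes finite_K: "finite K" and prob: "\<And>i. i \<in> K \<Longrightarrow> prob_space (P i)"
    and f[measurable]: "f \<in> borel_measurable (PiM K P)"
    and f_nonneg: "\<And>x. 0 \<le> f x" and f_le: "\<And>x. f x \<le> C"
    and g_upd: "\<And>i x y. i \<in> K \<Longrightarrow> g i (x(i := y)) = g i x"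
    and increments: "AE x in PiM K P. \<forall>i\<in>K. g i x \<le> f x \<and> f x \<le> g i x + 1"
    and sum_increments: "AE x in PiM K P. (\<Sum>i\<in>K. f x - g i x) \<le> a * f x"
begin

text \<open>Tensorization reduces to one coordinate at a time, where
  \<open>fun_entropy_exp_le\<close> applies with c = \<open>g i x\<close>; the sum of the
  increments, weighted by exp(l f), is then at most a f exp(l f).\<close>

lemma fun_entropy_exp_self_bounding:
  "fun_entropy (PiM K P) (\<lambda>x. exp (l * f x)) \<le> a * phi (- l) * (\<integral>x. f x * exp (l * f x) \<partial>PiM K P)"
proof (cases "l = 0")
  case True
  interpret prob_space "PiM K P" using prob by (intro prob_space_PiM)
  show ?thesis using True by (simp add: fun_entropy_def phi_def prob_space)
next
  case False
  then have ph: "0 < phi (- l)" by (intro phi_pos) auto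
  interpret prob_space "PiM K P" using prob by (intro prob_space_PiM)
  note ps = prob_space_axioms
  define D where "D = \<bar>l\<bar> * C"
  define Y where "Y x = exp (l * f x)" for x
  have absf: "\<bar>f x\<bar> \<le> C" for x using f_nonneg[of x] f_le[of x] by simp
  have C0: "0 \<le> C" using f_nonneg[of undefined] f_le[of undefined] by linarith
  have lf: "\<bar>l * f x\<bar> \<le> D" for x
    unfolding D_def abs_mult using absf by (intro mult_left_mono) auto
  have Yb: "exp (- D) \<le> Y x" "Y x \<le> exp D" for x
    using lf[of x] unfolding Y_def by auto
  have Y[measurable]: "Y \<in> borel_measurable (PiM K P)" unfolding Y_def by measurable
  have fY: "\<bar>f x * Y x\<bar> \<le> C * exp D" for x
    unfolding abs_mult using absf[of x] Yb(2)[of x] C0 by (intro mult_mono) (auto simp: Y_def)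
  have upd: "(\<lambda>z. (fst z)(i := snd z)) \<in> PiM K P \<Otimes>\<^sub>M P i \<rightarrow>\<^sub>M PiM K P" if "i \<in> K" for i
    using measurable_compose[OF measurable_pair_swap' measurable_upd_PiM[of i K K P]] that
    by (auto simp add: case_prod_beta')
  have fi: "(\<lambda>y. f (x(i := y))) \<in> borel_measurable (P i)" if "i \<in> K" "x \<in> space (PiM K P)" for i x
    using measurable_compose[OF measurable_Pair1'[OF that(2)] measurable_compose[OF upd[OF that(1)] f]] by simp
  define A where "A i x = fun_entropy (P i) (\<lambda>y. Y (x(i := y)))" for i x
  define B where "B i x = (\<integral>y. Y (x(i := y)) \<partial>P i)" for i x
  define G where "G i x = (\<integral>y. f (x(i := y)) * Y (x(i := y)) \<partial>P i)" for i x
  \<comment> \<open>The entropy bound in the coordinate \<open>i\<close> says exactly that \<open>g i \<le> h i\<close> almost everywhere. So \<open>h i\<close>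
    may replace \<open>g i\<close>, which is not assumed to be measurable.\<close>
  define h where "h i x = (G i x - A i x / phi (- l)) / B i x" for i x
  define c where "c = 2 * (exp D * max \<bar>ln (exp (- D))\<bar> \<bar>ln (exp D)\<bar>)"
  define H where "H = (C * exp D + c / phi (- l)) / exp (- D)"
  have Bb: "exp (- D) \<le> B i x" if "i \<in> K" "x \<in> space (PiM K P)" for i x
    unfolding B_def using fi[OF that] by (intro integral_between(1)[OF prob _ Yb] that) (simp add: Y_def)
  have Ab: "\<bar>A i x\<bar> \<le> c" if "i \<in> K" "x \<in> space (PiM K P)" for i x
    unfolding A_def c_def using fi[OF that] by (intro abs_fun_entropy_le prob that Yb) (auto simp: Y_def)
  have Gb: "\<bar>G i x\<bar> \<le> C * exp D" if "i \<in> K" for i x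
    unfolding G_def using fY by (intro abs_integral_le prob that)
  have hb: "\<bar>h i x\<bar> \<le> H" if "i \<in> K" "x \<in> space (PiM K P)" for i x
  proof -
    have "\<bar>A i x / phi (- l)\<bar> \<le> c / phi (- l)"
      using Ab[OF that] ph by (simp add: divide_right_mono)
    then have "\<bar>G i x - A i x / phi (- l)\<bar> \<le> C * exp D + c / phi (- l)"
      using Gb[OF that(1), of x] by linarith
    then show ?thesis unfolding h_def H_def abs_divide using Bb[OF that] by (intro frac_le) auto
  qed
  have Am[measurable]: "A i \<in> borel_measurable (PiM K P)" if "i \<in> K" for i
    unfolding A_def using that by (intro measurable_fun_entropy_upd[OF _ prob Y]) auto
  have Bm[measurable]: "B i \<in> borel_measurable (PiM K P)" if "i \<in> K" for i
  proof -
    interpret Pi: prob_space "P i" by (rule prob[OF that])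
    have "(\<lambda>(x, y). Y (x(i := y))) \<in> borel_measurable (PiM K P \<Otimes>\<^sub>M P i)"
      using measurable_compose[OF upd[OF that] Y] by (simp add: case_prod_beta')
    then show ?thesis unfolding B_def by (rule Pi.borel_measurable_lebesgue_integral)
  qed
  have Gm[measurable]: "G i \<in> borel_measurable (PiM K P)" if "i \<in> K" for i
  proof -
    interpret Pi: prob_space "P i" by (rule prob[OF that])
    have "(\<lambda>x. f x * Y x) \<in> borel_measurable (PiM K P)" by measurable
    from measurable_compose[OF upd[OF that] this]
    have "(\<lambda>(x, y). f (x(i := y)) * Y (x(i := y))) \<in> borel_measurable (PiM K P \<Otimes>\<^sub>M P i)"
      by (simp add: case_prod_beta')
    then show ?thesis unfolding G_def by (rule Pi.borel_measurable_lebesgue_integral)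
  qed
  have hm[measurable]: "h i \<in> borel_measurable (PiM K P)" if "i \<in> K" for i
    unfolding h_def using that by measurable
  have h_upd: "h i (x(i := y)) = h i x" for i x y
    by (simp add: h_def A_def B_def G_def)
  have iYh: "integrable (PiM K P) (\<lambda>x. Y x * (f x - h i x))" if "i \<in> K" for i
  proof (rule bounded_integrable[OF ps])
    show "\<bar>Y x * (f x - h i x)\<bar> \<le> exp D * (C + H)" if "x \<in> space (PiM K P)" for x
      unfolding abs_mult using Yb[of x] absf[of x] hb[OF \<open>i \<in> K\<close> that]
      by (intro mult_mono) (auto simp: Y_def)
  qed (use that in measurable)
  \<comment> \<open>Integrate coordinate i first: \<open>h i\<close> is constant there, and Y (f - h
    i) has integral \<open>G i - h i * B i\<close>, which is \<open>A i / phi (- l)\<close> by the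
    choice of \<open>h\<close>.\<close>
  have intA: "(\<integral>x. A i x \<partial>PiM K P) = phi (- l) * (\<integral>x. Y x * (f x - h i x) \<partial>PiM K P)" if "i \<in> K" for i
  proof -
    interpret Pi: prob_space "P i" by (rule prob[OF that])
    have iK: "insert i K = K" using that by auto
    have "(\<integral>x. Y x * (f x - h i x) \<partial>PiM K P) =
        (\<integral>x. (\<integral>y. Y (x(i := y)) * (f (x(i := y)) - h i (x(i := y))) \<partial>P i) \<partial>PiM K P)"
    proof (rule integral_PiM_upd(1)[OF iK prob])
      show "\<bar>Y x * (f x - h i x)\<bar> \<le> exp D * (C + H)" if "x \<in> space (PiM K P)" for x
        unfolding abs_mult using Yb[of x] absf[of x] hb[OF \<open>i \<in> K\<close> that]
        by (intro mult_mono) (auto simp: Y_def)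
    qed (use that in measurable)
    also have "\<dots> = (\<integral>x. A i x / phi (- l) \<partial>PiM K P)"
    proof (rule Bochner_Integration.integral_cong[OF refl])
      fix x assume x: "x \<in> space (PiM K P)"
      note [measurable] = fi[OF that x]
      have "integrable (P i) (\<lambda>y. f (x(i := y)) * Y (x(i := y)))"
        by (rule bounded_integrable[OF Pi.prob_space_axioms _ fY]) (simp add: Y_def)
      moreover have "integrable (P i) (\<lambda>y. Y (x(i := y)))"
        by (rule bounded_integrable[OF Pi.prob_space_axioms, of _ "exp D"]) (use Yb(2) in \<open>auto simp: Y_def\<close>)
      ultimately have "(\<integral>y. f (x(i := y)) * Y (x(i := y)) - h i x * Y (x(i := y)) \<partial>P i) = G i x - h i x * B i x"
        by (simp add: G_def B_def)
      also have "\<dots> = A i x / phi (- l)"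
        using less_le_trans[OF exp_gt_zero Bb[OF that x]] by (simp add: h_def)
      finally show "(\<integral>y. Y (x(i := y)) * (f (x(i := y)) - h i (x(i := y))) \<partial>P i) = A i x / phi (- l)"
        by (simp only: h_upd right_diff_distrib mult.commute)
    qed
    finally show ?thesis using ph by simp
  qed
  have gh: "AE x in PiM K P. \<forall>i\<in>K. g i x \<le> h i x"
    unfolding AE_finite_all[OF finite_K]
  proof
    fix i assume i: "i \<in> K"
    \<comment> \<open>For almost every x the increments are controlled along the whole fibre through
      x in direction i, which is the hypothesis of the one-coordinate bound.\<close>
    have "AE x in PiM K P. AE y in P i. \<forall>j\<in>K. g j (x(i := y)) \<le> f (x(i := y)) \<and> f (x(i := y)) \<le> g j (x(i := y)) + 1"
      by (rule AE_PiM_upd[OF i prob increments])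
    then show "AE x in PiM K P. g i x \<le> h i x"
      using AE_space
    proof eventually_elim
      case (elim x)
      have "A i x \<le> phi (- l) * (G i x - g i x * B i x)"
        unfolding A_def G_def B_def Y_def
      proof (rule fun_entropy_exp_le[OF prob[OF i] fi[OF i elim(2)] absf])
        show "AE y in P i. g i x \<le> f (x(i := y)) \<and> f (x(i := y)) \<le> g i x + 1"
          using elim(1) by eventually_elim (use i in \<open>auto simp: g_upd\<close>)
      qed
      then have "A i x / phi (- l) \<le> G i x - g i x * B i x"
        using ph by (simp add: pos_divide_le_eq mult.commute)
      then show "g i x \<le> h i x"
        unfolding h_def using less_le_trans[OF exp_gt_zero Bb[OF i elim(2)]]
        by (simp add: pos_le_divide_eq)
    qed
  qed
  have "fun_entropy (PiM K P) Y \<le> (\<Sum>i\<in>K. \<integral>x. A i x \<partial>PiM K P)"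
    unfolding A_def using Yb by (intro fun_entropy_PiM_le finite_K prob Y) auto
  also have "\<dots> = phi (- l) * (\<integral>x. (\<Sum>i\<in>K. Y x * (f x - h i x)) \<partial>PiM K P)"
    using iYh by (simp add: intA sum_distrib_left)
  also have "\<dots> \<le> phi (- l) * (\<integral>x. a * (f x * Y x) \<partial>PiM K P)"
  proof (intro mult_left_mono integral_mono_AE)
    show "integrable (PiM K P) (\<lambda>x. \<Sum>i\<in>K. Y x * (f x - h i x))" using iYh by auto
    show "integrable (PiM K P) (\<lambda>x. a * (f x * Y x))"
      using bounded_integrable[OF ps, of "\<lambda>x. f x * Y x", OF _ fY] by auto
    show "AE x in PiM K P. (\<Sum>i\<in>K. Y x * (f x - h i x)) \<le> a * (f x * Y x)"
      using gh sum_increments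
    proof eventually_elim
      case (elim x)
      have "(\<Sum>i\<in>K. Y x * (f x - h i x)) = Y x * (\<Sum>i\<in>K. f x - h i x)"
        by (simp add: sum_distrib_left)
      also have "\<dots> \<le> Y x * (\<Sum>i\<in>K. f x - g i x)"
        using elim by (intro mult_left_mono sum_mono) (auto simp: Y_def)
      also have "\<dots> \<le> Y x * (a * f x)"
        using elim by (intro mult_left_mono) (auto simp: Y_def)
      finally show ?case by (simp add: mult_ac)
    qed
  qed (use ph in auto)
  finally show ?thesis unfolding Y_def by (simp add: mult_ac)
qed

end

lemma abs_exp_minus_le:
  fixes u :: real
  assumes "\<bar>u\<bar> \<le> 1"
  shows "\<bar>exp u - 1 - u\<bar> \<le> u^2"
proof (cases "0 \<le> u")
  case True
  then have "exp u \<le> 1 + u + u^2" using assms by (intro exp_bound) auto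
  moreover have "1 + u \<le> exp u" by (rule exp_ge_add_one_self)
  ultimately show ?thesis unfolding abs_le_iff using zero_le_power2[of u] by linarith
next
  case False
  then have "phi (- (- u)) \<le> (- u)^2 / 2" by (intro phi_minus_le) auto
  then have "exp u - u - 1 \<le> u^2 / 2" by (simp add: phi_def)
  moreover have "1 + u \<le> exp u" by (rule exp_ge_add_one_self)
  ultimately show ?thesis unfolding abs_le_iff using zero_le_power2[of u] by linarith
qed

text \<open>As f is bounded by C, the first-order remainder at l + h is at most B h^2 uniformly in
  the sample point once |h| C \<le> 1. This survives integration.\<close>

lemma has_real_derivative_integral_exp:
  fixes f :: "'a \<Rightarrow> real"
  assumes "prob_space M" "f \<in> borel_measurable M" "\<And>x. \<bar>f x\<bar> \<le> C"
  shows "((\<lambda>l. \<integral>x. exp (l * f x) \<partial>M) has_real_derivative (\<integral>x. f x * exp (l * f x) \<partial>M)) (at l)"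
proof -
  interpret prob_space M by fact
  note [measurable] = assms(2)
  have C0: "0 \<le> C" using assms(3)[of undefined] by linarith
  have lf: "exp (t * f x) \<le> exp (\<bar>t\<bar> * C)" for t x
  proof -
    have "\<bar>t * f x\<bar> \<le> \<bar>t\<bar> * C" unfolding abs_mult using assms(3) by (intro mult_left_mono) auto
    then show ?thesis by simp
  qed
  have i1: "integrable M (\<lambda>x. exp (t * f x))" for t
    by (rule bounded_integrable[OF assms(1), of _ "exp (\<bar>t\<bar> * C)"]) (use lf in auto)
  have i2: "integrable M (\<lambda>x. f x * exp (l * f x))"
  proof (rule bounded_integrable[OF assms(1)])
    show "\<bar>f x * exp (l * f x)\<bar> \<le> C * exp (\<bar>l\<bar> * C)" for x
      unfolding abs_mult abs_exp_cancel using lf assms(3) C0 by (intro mult_mono) auto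
  qed simp
  define F where "F t = (\<integral>x. exp (t * f x) \<partial>M)" for t
  define d where "d = (\<integral>x. f x * exp (l * f x) \<partial>M)"
  define B where "B = exp (\<bar>l\<bar> * C) * C^2"
  have main: "\<bar>F (l + h) - F l - h * d\<bar> \<le> B * h^2" if "\<bar>h\<bar> * C \<le> 1" for h
  proof -
    have "F (l + h) - F l - h * d = (\<integral>x. exp ((l + h) * f x) - exp (l * f x) - h * (f x * exp (l * f x)) \<partial>M)"
      unfolding F_def d_def using i1 i2 by simp
    also have "\<bar>\<dots>\<bar> \<le> B * h^2"
    proof (rule abs_integral_le[OF assms(1)])
      fix x
      have hf: "\<bar>h * f x\<bar> \<le> \<bar>h\<bar> * C"
        unfolding abs_mult using assms(3) by (intro mult_left_mono) auto
      have "exp ((l + h) * f x) - exp (l * f x) - h * (f x * exp (l * f x)) = exp (l * f x) * (exp (h * f x) - 1 - h * f x)"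
        by (simp add: algebra_simps flip: exp_add)
      also have "\<bar>\<dots>\<bar> \<le> exp (\<bar>l\<bar> * C) * (\<bar>h\<bar> * C)^2"
        unfolding abs_mult[of "exp _"]
      proof (intro mult_mono)
        have "\<bar>exp (h * f x) - 1 - h * f x\<bar> \<le> (h * f x)^2"
          using hf that by (intro abs_exp_minus_le) linarith
        also have "\<dots> \<le> (\<bar>h\<bar> * C)^2" using hf by (intro abs_le_square_iff[THEN iffD1]) auto
        finally show "\<bar>exp (h * f x) - 1 - h * f x\<bar> \<le> (\<bar>h\<bar> * C)^2" .
      qed (use lf in auto)
      finally show "\<bar>exp ((l + h) * f x) - exp (l * f x) - h * (f x * exp (l * f x))\<bar> \<le> B * h^2"
        by (simp add: B_def power_mult_distrib mult_ac)
    qed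
    finally show ?thesis .
  qed
  have "(\<lambda>h. (F (l + h) - F l) / h - d) \<midarrow>0\<rightarrow> 0"
  proof (rule Lim_null_comparison)
    show "((\<lambda>h. B * \<bar>h\<bar>) \<longlongrightarrow> 0) (at 0)"
      by (auto intro!: tendsto_eq_intros)
    have "eventually (\<lambda>h. \<bar>h\<bar> * C < 1) (at (0::real))"
      by (rule order_tendstoD(2)[of _ 0]) (auto intro!: tendsto_eq_intros)
    then show "eventually (\<lambda>h. norm ((F (l + h) - F l) / h - d) \<le> B * \<bar>h\<bar>) (at 0)"
      using eventually_neq_at_within[of "0::real" 0 UNIV]
    proof eventually_elim
      case (elim h)
      have "(F (l + h) - F l) / h - d = (F (l + h) - F l - h * d) / h"
        using elim by (simp add: field_simps)
      also have "norm \<dots> \<le> B * h^2 / \<bar>h\<bar>"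
        unfolding real_norm_def abs_divide using elim by (intro divide_right_mono main) auto
      also have "\<dots> = B * \<bar>h\<bar>" using elim by (simp add: power2_eq_square field_simps)
      finally show ?case .
    qed
  qed
  then have "(\<lambda>h. (F (l + h) - F l) / h) \<midarrow>0\<rightarrow> d"
    by (rule LIM_zero_cancel)
  then show ?thesis unfolding DERIV_def F_def d_def .
qed

section \<open>From the entropy inequality to exponential tails\<close>

locale exp_entropy_bound = prob_space M for M :: "'a measure" +
  fixes f :: "'a \<Rightarrow> real" and a C :: real
  assumes f[measurable]: "f \<in> borel_measurable M"
    and f_nonneg: "\<And>x. 0 \<le> f x" and f_le: "\<And>x. f x \<le> C"
    and a: "a \<ge> 1 / 3"
    and fun_entropy_bound: "\<And>l. fun_entropy M (\<lambda>x. exp (l * f x)) \<le> a * phi (- l) * (\<integral>x. f x * exp (l * f x) \<partial>M)"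
begin

abbreviation "v \<equiv> \<integral>x. f x \<partial>M"

definition "L l = ln (\<integral>x. exp (l * f x) \<partial>M)"
definition "L' l = (\<integral>x. f x * exp (l * f x) \<partial>M) / (\<integral>x. exp (l * f x) \<partial>M)"

lemma abs_f_le: "\<bar>f x\<bar> \<le> C"
  using f_nonneg[of x] f_le[of x] by simp

lemma integrable_exp: "integrable M (\<lambda>x. exp (l * f x))"
proof (rule bounded_integrable[OF prob_space_axioms])
  show "\<bar>exp (l * f x)\<bar> \<le> exp (\<bar>l\<bar> * C)" for x
    using mult_left_mono[OF abs_f_le[of x], of "\<bar>l\<bar>"] by (simp flip: abs_mult)
qed simp

lemma integral_exp_pos: "0 < (\<integral>x. exp (l * f x) \<partial>M)"
proof -
  have "exp (- (\<bar>l\<bar> * C)) \<le> (\<integral>x. exp (l * f x) \<partial>M)"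
  proof (rule integral_ge_const[OF integrable_exp])
    show "AE x in M. exp (- (\<bar>l\<bar> * C)) \<le> exp (l * f x)"
      using mult_left_mono[OF abs_f_le, of "\<bar>l\<bar>"] by (auto simp flip: abs_mult simp: abs_le_iff minus_le_iff)
  qed
  then show ?thesis using exp_gt_zero less_le_trans by blast
qed

lemma L'_nonneg: "0 \<le> L' l"
  unfolding L'_def using integral_exp_pos[of l] f_nonneg by (intro divide_nonneg_pos integral_nonneg_AE) auto

lemma DERIV_L: "(L has_real_derivative L' l) (at l)"
  unfolding L_def[abs_def] L'_def
  using has_real_derivative_integral_exp[OF prob_space_axioms f abs_f_le, of l] integral_exp_pos[of l]
  by (auto intro!: derivative_eq_intros simp: field_simps)

lemma L_0: "L 0 = 0" "L' 0 = v"
  by (simp_all add: L_def L'_def prob_space)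

text \<open>The entropy of exp(l f) divided by its mean is l L'(l) - L(l). Dividing the entropy
  bound by that mean gives the differential inequality.\<close>

lemma L_entropy: "l * L' l - L l \<le> a * phi (- l) * L' l"
proof -
  let ?F = "\<integral>x. exp (l * f x) \<partial>M" and ?G = "\<integral>x. f x * exp (l * f x) \<partial>M"
  have "fun_entropy M (\<lambda>x. exp (l * f x)) = l * ?G - ?F * L l"
    by (simp add: fun_entropy_def L_def mult_ac flip: integral_mult_right_zero)
  then have "(l * ?G - ?F * L l) / ?F \<le> a * phi (- l) * ?G / ?F"
    using fun_entropy_bound[of l] integral_exp_pos[of l] by (intro divide_right_mono) auto
  then show ?thesis using integral_exp_pos[of l] by (simp add: L'_def diff_divide_distrib)
qed

text \<open>\<open>L l / l - a / 2 * L l\<close> is decreasing in \<open>l > 0\<close> and tends to \<open>v\<close> at \<open>0\<close>.\<close>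

lemma L_le_upper:
  assumes "0 < l" "a * l < 2"
  shows "L l \<le> v * l / (1 - a * l / 2)"
proof -
  define Q where "Q l = L l / l - a / 2 * L l" for l
  have mono: "Q l \<le> Q e" if "0 < e" "e \<le> l" for e
  proof (rule DERIV_nonpos_imp_nonincreasing[OF that(2)])
    fix x assume "e \<le> x"
    with that have x: "0 < x" by simp
    have "(Q has_real_derivative ((x * L' x - L x) / x^2 - a / 2 * L' x)) (at x)"
      unfolding Q_def using x DERIV_L[of x]
      by (auto intro!: derivative_eq_intros simp: field_simps power2_eq_square)
    \<comment> \<open>The left side is the derivative of L(x) / x; \<open>phi (- x)\<close> \<le>
      x^2 / 2 bounds it by the derivative of a / 2 * L.\<close>
    moreover have "(x * L' x - L x) / x^2 \<le> a * (x^2 / 2) * L' x / x^2"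
    proof (rule divide_right_mono)
      have "a * phi (- x) * L' x \<le> a * (x^2 / 2) * L' x"
        using phi_minus_le[of x] x a L'_nonneg by (intro mult_right_mono mult_left_mono) auto
      then show "x * L' x - L x \<le> a * (x^2 / 2) * L' x" using L_entropy[of x] by linarith
    qed simp
    moreover have "a * (x^2 / 2) * L' x / x^2 = a / 2 * L' x" using x by simp
    ultimately show "\<exists>y. DERIV Q x :> y \<and> y \<le> 0"
      by (intro exI[of _ "(x * L' x - L x) / x^2 - a / 2 * L' x"] conjI) (assumption, linarith)
  qed
  have "((\<lambda>e. L e / e) \<longlongrightarrow> v) (at_right 0)"
    using DERIV_L[of 0] L_0 filterlim_mono[OF _ order_refl at_le[OF subset_UNIV]]
    by (auto simp: DERIV_def)
  moreover have "(L \<longlongrightarrow> 0) (at_right 0)"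
    using DERIV_isCont[OF DERIV_L[of 0]] L_0 filterlim_mono[OF _ order_refl at_le[OF subset_UNIV]]
    by (auto simp: isCont_def)
  ultimately have "(Q \<longlongrightarrow> v - a / 2 * 0) (at_right 0)"
    unfolding Q_def by (intro tendsto_intros)
  then have "Q l \<le> v - a / 2 * 0"
  proof (rule tendsto_lowerbound)
    show "eventually (\<lambda>e. Q l \<le> Q e) (at_right 0)"
      using mono assms(1) by (auto simp: eventually_at_right intro!: exI[of _ l])
  qed auto
  then show ?thesis using assms by (simp add: Q_def field_simps)
qed

text \<open>\<open>- L (- m) / (m - a * m^2 / 2)\<close> is increasing in \<open>m\<close> and tends to \<open>v\<close> at \<open>0\<close>.\<close>

lemma L_le_lower:
  assumes "0 < m" "a * m < 1"
  shows "L (- m) \<le> a * v * m^2 / 2 - v * m"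
proof -
  define q where "q m = m - a * m^2 / 2" for m
  define R where "R m = - L (- m) / q m" for m
  have q: "0 < q x" if "0 < x" "x \<le> m" for x
  proof -
    have "a * x \<le> a * m" using that a by (intro mult_left_mono) auto
    then have "0 < x * (1 - a * x / 2)" using that assms by (intro mult_pos_pos) auto
    then show ?thesis by (simp add: q_def algebra_simps power2_eq_square)
  qed
  have mono: "R e \<le> R m" if "0 < e" "e \<le> m" for e
  proof (rule DERIV_nonneg_imp_nondecreasing[OF that(2)])
    fix x assume "e \<le> x" "x \<le> m"
    with that have x: "0 < x" "x \<le> m" by auto
    have "a * x \<le> a * m" using x a by (intro mult_left_mono) auto
    then have ax: "a * x < 1" using assms by simp
    have dL: "((\<lambda>m. L (- m)) has_real_derivative - L' (- x)) (at x)"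
      by (rule DERIV_mirror[THEN iffD1, OF DERIV_L])
    have dq: "(q has_real_derivative (1 - a * x)) (at x)"
      unfolding q_def by (auto intro!: derivative_eq_intros)
    have d: "(R has_real_derivative ((L' (- x) * q x + L (- x) * (1 - a * x)) / (q x)^2)) (at x)"
      using DERIV_divide[OF DERIV_minus[OF dL] dq] q[OF x] by (simp add: R_def[abs_def] power2_eq_square)
    \<comment> \<open>The derivative of R is nonnegative iff - L(-x) (1 - a x) \<le> L'(-x) q(x).
      Since - L(-x) \<le> (x + a phi x) L'(-x), it suffices that (x + a phi x) (1 - a x) \<le> q x,
      that is, phi x (1 - a x) \<le> x^2 / 2. Here a \<ge> 1/3 enters.\<close>
    have "phi x * (1 - a * x) \<le> phi x * (1 - x / 3)"
      using a x phi_pos[of x] mult_right_mono[OF a, of x] by (intro mult_left_mono) auto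
    also have "\<dots> \<le> x^2 / 2" using x by (intro phi_mult_third_le) auto
    finally have "a * (phi x * (1 - a * x)) \<le> a * (x^2 / 2)" using a by (intro mult_left_mono) auto
    then have *: "(x + a * phi x) * (1 - a * x) \<le> q x"
      by (simp add: q_def algebra_simps power2_eq_square)
    have "- L (- x) \<le> (x + a * phi x) * L' (- x)" using L_entropy[of "- x"] by (simp add: algebra_simps)
    then have "- L (- x) * (1 - a * x) \<le> (x + a * phi x) * L' (- x) * (1 - a * x)"
      using ax by (intro mult_right_mono) auto
    also have "\<dots> \<le> q x * L' (- x)" using mult_right_mono[OF * L'_nonneg[of "- x"]] by (simp add: mult_ac)
    finally have "0 \<le> (L' (- x) * q x + L (- x) * (1 - a * x)) / (q x)^2"
      by (intro divide_nonneg_nonneg) (auto simp: mult_ac)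
    with d show "\<exists>y. DERIV R x :> y \<and> 0 \<le> y" by blast
  qed
  have "(\<lambda>e. - L (- e) / e) \<midarrow>0\<rightarrow> v"
    using DERIV_minus[OF DERIV_mirror[THEN iffD1, OF DERIV_L[of "- 0"]]] L_0 by (simp add: DERIV_def)
  then have "((\<lambda>e. - L (- e) / e) \<longlongrightarrow> v) (at_right 0)"
    by (rule filterlim_mono[OF _ order_refl at_le[OF subset_UNIV]])
  then have "((\<lambda>e. (- L (- e) / e) / (1 - a * e / 2)) \<longlongrightarrow> v / (1 - a * 0 / 2)) (at_right 0)"
    by (intro tendsto_intros) auto
  moreover have "q e = e * (1 - a * e / 2)" for e
    by (simp add: q_def power2_eq_square algebra_simps)
  then have "(\<lambda>e. (- L (- e) / e) / (1 - a * e / 2)) = R"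
    by (intro ext) (simp add: R_def)
  ultimately have "(R \<longlongrightarrow> v) (at_right 0)" by simp
  then have "v \<le> R m"
  proof (rule tendsto_upperbound)
    show "eventually (\<lambda>e. R e \<le> R m) (at_right 0)"
      using mono assms(1) by (auto simp: eventually_at_right intro!: exI[of _ m])
  qed auto
  then have "v * q m \<le> - L (- m)" using q[of m] assms(1) by (simp only: R_def pos_le_divide_eq)
  then show ?thesis by (simp add: q_def algebra_simps)
qed

lemma prob_le_exp: "prob {y \<in> space M. t \<le> l * f y} \<le> exp (L l - t)"
proof -
  have "prob {y \<in> space M. exp t \<le> exp (l * f y)} \<le> (\<integral>y. exp (l * f y) \<partial>M) / exp t"
    using integrable_exp by (intro integral_Markov_inequality_measure[of _ _ "{}"]) auto
  also have "\<dots> = exp (L l - t)"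
    using integral_exp_pos[of l] by (simp add: L_def exp_diff)
  finally show ?thesis by simp
qed

lemma v_nonneg: "0 \<le> v"
  using f_nonneg by (intro integral_nonneg_AE) auto

lemma upper_tail:
  assumes x: "0 < x"
  shows "prob {y \<in> space M. v + sqrt (2 * a * v * x) + a / 2 * x < f y} \<le> exp (- x)"
\<comment> \<open>For v = 0 the optimal parameter below would be 2 / a, the pole of the bound on L;
  but then f vanishes almost everywhere.\<close>
proof (cases "v = 0")
  case True
  have "integrable M f"
    by (rule bounded_integrable[OF prob_space_axioms f abs_f_le])
  then have "AE y in M. f y = 0"
    using True f_nonneg by (simp add: integral_nonneg_eq_0_iff_AE)
  then have "AE y in M. y \<notin> {y \<in> space M. v + sqrt (2 * a * v * x) + a / 2 * x < f y}"
  proof eventually_elim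
    case (elim y)
    have "0 < a / 2 * x" using a x by (intro mult_pos_pos) auto
    then show ?case using elim True by auto
  qed
  then have "prob {y \<in> space M. v + sqrt (2 * a * v * x) + a / 2 * x < f y} = 0"
    by (subst prob_eq_0) auto
  then show ?thesis by simp
next
  case False
  \<comment> \<open>These square roots make v + s equal to (w + r)^2, so that the optimization below
    has a rational solution.\<close>
  define c w r s where "c = a / 2" and "w = sqrt v" and "r = sqrt (c * x)" and "s = 2 * w * r + r^2"
  have c: "0 < c" using a by (simp add: c_def)
  have w: "0 < w" "w^2 = v" using False v_nonneg by (auto simp: w_def)
  have r: "0 < r" "r^2 = c * x" using c x by (auto simp: r_def)
  have s: "v + sqrt (2 * a * v * x) + a / 2 * x = v + s"
  proof -
    have "sqrt (2 * a * v * x) = sqrt (2^2 * (v * (c * x)))"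
      by (simp add: c_def mult_ac)
    also have "\<dots> = 2 * w * r" unfolding w_def r_def real_sqrt_mult by simp
    finally show ?thesis using r(2) by (simp add: s_def c_def)
  qed
  \<comment> \<open>The minimizer of v l / (1 - c l) - l (v + s): the critical equation v / (1 - c
    l)^2 = (w + r)^2 says 1 - c l = w / (w + r). The minimum is - r^2 / c = - x.\<close>
  define l where "l = r / (c * (w + r))"
  have wr: "0 < w + r" using w r by simp
  have l: "0 < l" "c * l = r / (w + r)" using c wr r by (auto simp: l_def)
  have cl: "1 - c * l = w / (w + r)" using wr unfolding l(2) by (simp add: field_simps)
  have "a * l = 2 * (r / (w + r))" unfolding l(2)[symmetric] by (simp add: c_def)
  moreover have "r / (w + r) < 1" using wr w by simp
  ultimately have "a * l < 2" by linarith
  from L_le_upper[OF l(1) this] have "L l \<le> v * l / (1 - c * l)" by (simp add: c_def)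
  also have "\<dots> = w^2 * l / (w / (w + r))" unfolding cl w(2) ..
  also have "\<dots> = w * r / c"
  proof -
    have "w^2 * (r / (c * u)) / (w / u) = w * r / c" if "0 < u" for u
      using that w(1) c by (simp add: field_simps power2_eq_square)
    from this[OF wr] show ?thesis unfolding l_def .
  qed
  finally have "L l - l * (v + s) \<le> w * r / c - l * (w^2 + s)" using w by simp
  also have "l * (w^2 + s) = r * (w + r) / c"
  proof -
    have "w^2 + s = (w + r)^2" by (simp add: s_def power2_eq_square algebra_simps)
    moreover have "r / (c * u) * u^2 = r * u / c" if "0 < u" for u
      using that c by (simp add: field_simps power2_eq_square)
    ultimately show ?thesis using wr unfolding l_def by metis
  qed
  also have "w * r / c - r * (w + r) / c = - (r^2 / c)"
    using c by (simp add: field_simps power2_eq_square)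
  also have "\<dots> = - x" using r(2) c by simp
  finally have L: "L l - l * (v + s) \<le> - x" .
  have "prob {y \<in> space M. v + s < f y} \<le> prob {y \<in> space M. l * (v + s) \<le> l * f y}"
    using l(1) by (intro finite_measure_mono) auto
  also have "\<dots> \<le> exp (L l - l * (v + s))" by (rule prob_le_exp)
  also have "\<dots> \<le> exp (- x)" using L by simp
  finally show ?thesis unfolding s .
qed

lemma lower_tail:
  assumes x: "0 < x"
  shows "prob {y \<in> space M. f y < v - sqrt (2 * a * v * x)} \<le> exp (- x)"
\<comment> \<open>If the deviation is at least v, the event is empty as f \<ge> 0. Otherwise s < v,
  which is the condition a m < 1 of \<open>L_le_lower\<close>.\<close>
proof (cases "sqrt (2 * a * v * x) < v")
  case False
  then have "\<not> f y < v - sqrt (2 * a * v * x)" for y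
    using f_nonneg[of y] by linarith
  then have "{y \<in> space M. f y < v - sqrt (2 * a * v * x)} = {}" by simp
  then show ?thesis by (simp only: measure_empty) simp
next
  case True
  define s where "s = sqrt (2 * a * v * x)"
  have v: "0 < v" using True v_nonneg by (cases "v = 0") auto
  have a0: "0 < a" using a by simp
  have s: "0 < s" "s^2 = 2 * a * v * x" "s < v" using v a0 x True by (auto simp: s_def)
  \<comment> \<open>The minimizer of the quadratic a v m^2 / 2 - m s.\<close>
  define m where "m = s / (a * v)"
  have m: "0 < m" "a * m < 1" using s v a0 by (auto simp: m_def)
  have "L (- m) - - m * (v - s) \<le> a * v * m^2 / 2 - m * s"
    using L_le_lower[OF m] by (simp add: algebra_simps)
  also have "\<dots> = - (s^2 / (2 * a * v))"
    unfolding m_def using a0 v by (simp add: field_simps power2_eq_square)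
  also have "\<dots> = - x" unfolding s(2) using a0 v by simp
  finally have L: "L (- m) - - m * (v - s) \<le> - x" .
  have "prob {y \<in> space M. f y < v - s} \<le> prob {y \<in> space M. - m * (v - s) \<le> - m * f y}"
    using m(1) by (intro finite_measure_mono) auto
  also have "\<dots> \<le> exp (L (- m) - - m * (v - s))" by (rule prob_le_exp)
  also have "\<dots> \<le> exp (- x)" using L by simp
  finally show ?thesis unfolding s_def .
qed

end

section \<open>Suprema of exchangeably weighted sums\<close>

declare One_nat_def [simp del]

definition wsup :: "('e \<Rightarrow> real) set \<Rightarrow> nat \<Rightarrow> (nat \<Rightarrow> 'e) \<Rightarrow> (nat \<Rightarrow> real) \<Rightarrow> real"
  where "wsup T n x c = (SUP t\<in>T. \<Sum>i=1..n. c i * t (x i))"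

text \<open>The bound is imposed at the n points only, since the members of T are controlled only on
  \<open>space E\<close>.\<close>

locale bounded_functions =
  fixes T :: "('e \<Rightarrow> real) set" and n :: nat and x :: "nat \<Rightarrow> 'e"
  assumes T_nonempty: "T \<noteq> {}" and T_le_1: "\<And>t i. t \<in> T \<Longrightarrow> i \<in> {1..n} \<Longrightarrow> \<bar>t (x i)\<bar> \<le> 1"
begin

lemma abs_weighted_sum_le:
  assumes "t \<in> T"
  shows "\<bar>\<Sum>i=1..n. c i * t (x i)\<bar> \<le> (\<Sum>i=1..n. \<bar>c i\<bar>)"
proof -
  have "\<bar>\<Sum>i=1..n. c i * t (x i)\<bar> \<le> (\<Sum>i=1..n. \<bar>c i * t (x i)\<bar>)" by (rule sum_abs)
  also have "\<dots> \<le> (\<Sum>i=1..n. \<bar>c i\<bar>)"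
    unfolding abs_mult using T_le_1[OF assms] by (intro sum_mono mult_left_le) auto
  finally show ?thesis .
qed

lemma bdd_above_weighted_sums: "bdd_above ((\<lambda>t. \<Sum>i=1..n. c i * t (x i)) ` T)"
  using abs_weighted_sum_le[of _ c] by (intro bdd_aboveI[of _ "\<Sum>i=1..n. \<bar>c i\<bar>"]) force

lemma wsup_upper: "t \<in> T \<Longrightarrow> (\<Sum>i=1..n. c i * t (x i)) \<le> wsup T n x c"
  unfolding wsup_def by (intro cSUP_upper bdd_above_weighted_sums)

lemma wsup_least: "(\<And>t. t \<in> T \<Longrightarrow> (\<Sum>i=1..n. c i * t (x i)) \<le> b) \<Longrightarrow> wsup T n x c \<le> b"
  unfolding wsup_def using T_nonempty by (intro cSUP_least)

lemma wsup_cong: "(\<And>i. i \<in> {1..n} \<Longrightarrow> c i = d i) \<Longrightarrow> wsup T n x c = wsup T n x d"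
  unfolding wsup_def by (auto intro!: SUP_cong sum.cong)

lemma wsup_diff_le: "wsup T n x c - wsup T n x d \<le> (\<Sum>i=1..n. \<bar>c i - d i\<bar>)"
proof -
  have "wsup T n x c \<le> wsup T n x d + (\<Sum>i=1..n. \<bar>c i - d i\<bar>)"
  proof (rule wsup_least)
    fix t assume t: "t \<in> T"
    have "(\<Sum>i=1..n. c i * t (x i)) = (\<Sum>i=1..n. d i * t (x i)) + (\<Sum>i=1..n. (c i - d i) * t (x i))"
      by (simp add: algebra_simps flip: sum.distrib)
    then show "(\<Sum>i=1..n. c i * t (x i)) \<le> wsup T n x d + (\<Sum>i=1..n. \<bar>c i - d i\<bar>)"
      using wsup_upper[OF t, of d] abs_weighted_sum_le[OF t, of "\<lambda>i. c i - d i"] by linarith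
  qed
  then show ?thesis by simp
qed

lemma abs_wsup_le: "\<bar>wsup T n x c\<bar> \<le> (\<Sum>i=1..n. \<bar>c i\<bar>)"
proof -
  have "wsup T n x (\<lambda>_. 0) = 0"
    unfolding wsup_def using T_nonempty by simp
  then show ?thesis
    using wsup_diff_le[of c "\<lambda>_. 0"] wsup_diff_le[of "\<lambda>_. 0" c] by (simp add: abs_le_iff)
qed

text \<open>A supremum of linear functions of the weights is sublinear; this gives the Jensen step
  over the exchanges.\<close>

lemma wsup_mean_le:
  "wsup T n x (\<lambda>j. (\<Sum>k\<in>I. c k j) / r) \<le> (\<Sum>k\<in>I. wsup T n x (c k)) / r" if "0 \<le> r" for r :: real
proof (rule wsup_least)
  fix t assume t: "t \<in> T"
  have "(\<Sum>i=1..n. (\<Sum>k\<in>I. c k i) / r * t (x i)) = (\<Sum>k\<in>I. \<Sum>i=1..n. c k i * t (x i)) / r"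
    by (subst sum.swap) (simp add: sum_distrib_right sum_divide_distrib)
  also have "\<dots> \<le> (\<Sum>k\<in>I. wsup T n x (c k)) / r"
    using that by (intro divide_right_mono sum_mono wsup_upper t) auto
  finally show "(\<Sum>i=1..n. (\<Sum>k\<in>I. c k i) / r * t (x i)) \<le> (\<Sum>k\<in>I. wsup T n x (c k)) / r" .
qed

text \<open>The supremum may be uncountable, but as a function of the weights it is lower semicontinuous.\<close>

lemma borel_measurable_wsup:
  assumes "\<And>i. i \<in> {1..n} \<Longrightarrow> u i \<in> borel_measurable N"
  shows "(\<lambda>\<omega>. wsup T n x (\<lambda>i. u i \<omega>)) \<in> borel_measurable N"
proof (rule borel_measurableI_greater)
  fix a
  define U where "U = (\<Union>t\<in>T. {c :: nat \<Rightarrow> real. a < (\<Sum>i=1..n. c i * t (x i))})"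
  \<comment> \<open>Measurability into nat => real concerns every coordinate, so those outside 1..n,
    about which nothing is known, are set to 0.\<close>
  define u' where "u' \<omega> i = (if i \<in> {1..n} then u i \<omega> else 0)" for \<omega> i
  have "open U" unfolding U_def
    by (intro open_UN ballI open_Collect_less continuous_intros continuous_on_product_coordinates)
  moreover have "u' \<in> borel_measurable N"
  proof (rule measurable_coordinatewise_then_product)
    show "(\<lambda>\<omega>. u' \<omega> i) \<in> borel_measurable N" for i
      unfolding u'_def using assms by (cases "i \<in> {1..n}") auto
  qed
  ultimately have "u' -` U \<inter> space N \<in> sets N"
    by (intro measurable_sets[of _ _ borel]) auto
  also have "u' -` U \<inter> space N = {\<omega> \<in> space N. a < wsup T n x (\<lambda>i. u i \<omega>)}"
    unfolding wsup_def less_cSUP_iff[OF T_nonempty bdd_above_weighted_sums]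
    by (auto simp: U_def u'_def)
  finally show "{\<omega> \<in> space N. a < wsup T n x (\<lambda>i. u i \<omega>)} \<in> sets N" .
qed

end

section \<open>Exchangeability and averaged transpositions\<close>

lemma integral_exchangeable:
  fixes h :: "(nat \<Rightarrow> real) \<Rightarrow> real"
  assumes "exchangeable N n \<xi>" "\<pi> permutes {1..n}"
    and \<xi>: "\<And>i. i \<in> {1..n} \<Longrightarrow> \<xi> i \<in> borel_measurable N"
    and h: "h \<in> borel_measurable (Pi\<^sub>M {1..n} (\<lambda>_. borel))"
  shows "(\<integral>\<omega>. h (\<lambda>i\<in>{1..n}. \<xi> (\<pi> i) \<omega>) \<partial>N) = (\<integral>\<omega>. h (\<lambda>i\<in>{1..n}. \<xi> i \<omega>) \<partial>N)"
    and "integrable N (\<lambda>\<omega>. h (\<lambda>i\<in>{1..n}. \<xi> (\<pi> i) \<omega>)) \<longleftrightarrow> integrable N (\<lambda>\<omega>. h (\<lambda>i\<in>{1..n}. \<xi> i \<omega>))"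
proof -
  have m: "(\<lambda>\<omega>. \<lambda>i\<in>{1..n}. \<xi> (\<pi> i) \<omega>) \<in> N \<rightarrow>\<^sub>M Pi\<^sub>M {1..n} (\<lambda>_. borel)"
    "(\<lambda>\<omega>. \<lambda>i\<in>{1..n}. \<xi> i \<omega>) \<in> N \<rightarrow>\<^sub>M Pi\<^sub>M {1..n} (\<lambda>_. borel)"
    using \<xi> permutes_in_image[OF assms(2)] by (auto intro!: measurable_restrict)
  have "joint_law N borel n (\<lambda>i. \<xi> (\<pi> i)) = joint_law N borel n \<xi>"
    using assms(1,2) unfolding exchangeable_def by blast
  then show "(\<integral>\<omega>. h (\<lambda>i\<in>{1..n}. \<xi> (\<pi> i) \<omega>) \<partial>N) = (\<integral>\<omega>. h (\<lambda>i\<in>{1..n}. \<xi> i \<omega>) \<partial>N)"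
    "integrable N (\<lambda>\<omega>. h (\<lambda>i\<in>{1..n}. \<xi> (\<pi> i) \<omega>)) \<longleftrightarrow> integrable N (\<lambda>\<omega>. h (\<lambda>i\<in>{1..n}. \<xi> i \<omega>))"
    unfolding joint_law_def by (metis integral_distr[OF m(1) h] integral_distr[OF m(2) h],
      metis integrable_distr_eq[OF m(1) h] integrable_distr_eq[OF m(2) h])
qed

text \<open>The average over \<open>k\<close> of \<open>\<xi>\<close> with the entries \<open>i\<close> and \<open>k\<close> exchanged; its entry \<open>i\<close> vanishes
  since the \<open>\<xi> k\<close> add up to \<open>0\<close>.\<close>

definition swap_mean :: "nat \<Rightarrow> (nat \<Rightarrow> real) \<Rightarrow> nat \<Rightarrow> nat \<Rightarrow> real"
  where "swap_mean n c i j = (if j = i then 0 else c j + (c i - c j) / n)"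

definition gbar_swap :: "'w measure \<Rightarrow> nat \<Rightarrow> (nat \<Rightarrow> 'w \<Rightarrow> real) \<Rightarrow> ('e \<Rightarrow> real) set \<Rightarrow> nat \<Rightarrow> (nat \<Rightarrow> 'e) \<Rightarrow> real"
  where "gbar_swap N n \<xi> T i x = (\<integral>\<omega>. wsup T n x (swap_mean n (\<lambda>j. \<xi> j \<omega>) i) \<partial>N)"

lemma gbar_swap_upd:
  fixes T :: "('e \<Rightarrow> real) set"
  shows "gbar_swap N n \<xi> T i (x(i := y)) = gbar_swap N n \<xi> T i x"
proof -
  have "(\<Sum>j=1..n. swap_mean n c i j * t ((x(i := y)) j)) = (\<Sum>j=1..n. swap_mean n c i j * t (x j))" for c and t :: "'e \<Rightarrow> real"
    by (intro sum.cong) (auto simp: swap_mean_def)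
  then show ?thesis by (simp add: gbar_swap_def wsup_def)
qed

text \<open>For j \<noteq> i only the exchange with k = j alters entry j, into c i; at j = i every c
  k appears once. The closed form in \<open>swap_mean\<close> vanishes at i for all weights, so that
  \<open>gbar_swap_upd\<close> holds without exceptional sets.\<close>

lemma swap_mean_eq_mean:
  assumes "i \<in> {1..n}" "j \<in> {1..n}" "(\<Sum>k=1..n. c k) = 0"
  shows "swap_mean n c i j = (\<Sum>k=1..n. c (Transposition.transpose i k j)) / n"
proof (cases "j = i")
  case True
  then show ?thesis using assms by (simp add: swap_mean_def)
next
  case False
  have "(\<Sum>k=1..n. c (Transposition.transpose i k j)) = (\<Sum>k=1..n. c j + (if k = j then c i - c j else 0))"
    using False by (intro sum.cong) (auto simp: Transposition.transpose_def)
  also have "\<dots> = n * c j + (c i - c j)" using assms by (simp add: sum.distrib)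
  finally show ?thesis using False assms by (simp add: swap_mean_def add_divide_distrib)
qed

text \<open>The term i = j loses c j once. Each of the other n - 1 terms loses c j / n, and the c i
  / n they gain add up to - c j / n, a second c j in total. Hence the self-bounding parameter
  2.\<close>

lemma sum_swap_mean:
  assumes "j \<in> {1..n}" "(\<Sum>k=1..n. c k) = 0"
  shows "(\<Sum>i=1..n. swap_mean n c i j) = (real n - 2) * c j"
proof -
  have "(\<Sum>i=1..n. swap_mean n c i j) = (\<Sum>i=1..n. (1 - 1 / n) * c j + c i / n - (if i = j then c j else 0))"
    by (intro sum.cong) (auto simp: swap_mean_def diff_divide_distrib algebra_simps)
  also have "\<dots> = n * ((1 - 1 / n) * c j) - c j"
    using assms by (simp add: sum_subtractf sum.distrib flip: sum_divide_distrib)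
  also have "\<dots> = (real n - 2) * c j" using assms by (simp add: field_simps)
  finally show ?thesis .
qed

locale exchangeable_weights = prob_space N + bounded_functions T n x
  for N :: "'w measure" and T :: "('e \<Rightarrow> real) set" and n x +
  fixes \<xi> :: "nat \<Rightarrow> 'w \<Rightarrow> real" and \<kappa> :: real
  assumes n: "n \<ge> 1"
    and \<xi>: "\<And>i. i \<in> {1..n} \<Longrightarrow> \<xi> i \<in> borel_measurable N"
    and exch: "exchangeable N n \<xi>"
    and int_1: "integrable N (\<lambda>\<omega>. \<bar>\<xi> 1 \<omega>\<bar>)"
    and \<kappa>: "\<kappa> = (\<integral>\<omega>. \<bar>\<xi> 1 \<omega>\<bar> \<partial>N)"
    and sum_0: "AE \<omega> in N. (\<Sum>i=1..n. \<xi> i \<omega>) = 0"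
begin

lemma integral_abs_weight:
  assumes "i \<in> {1..n}"
  shows "(\<integral>\<omega>. \<bar>\<xi> i \<omega>\<bar> \<partial>N) = \<kappa>" "integrable N (\<lambda>\<omega>. \<bar>\<xi> i \<omega>\<bar>)"
proof -
  have p: "Transposition.transpose 1 i permutes {1..n}" using assms by (intro permutes_swap_id) auto
  have m: "(\<lambda>c. \<bar>c 1\<bar>) \<in> borel_measurable (Pi\<^sub>M {1..n} (\<lambda>_. borel :: real measure))"
    using n by (intro borel_measurable_abs measurable_component_singleton) auto
  show "(\<integral>\<omega>. \<bar>\<xi> i \<omega>\<bar> \<partial>N) = \<kappa>" "integrable N (\<lambda>\<omega>. \<bar>\<xi> i \<omega>\<bar>)"
    using integral_exchangeable[OF exch p \<xi> m] n int_1 \<kappa> by auto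
qed

lemma gbar_eq: "gbar N n \<xi> T x = (\<integral>\<omega>. wsup T n x (\<lambda>i. \<xi> i \<omega>) \<partial>N)"
  by (simp add: gbar_def wsup_def)

lemma integral_wsup_permuted:
  assumes "\<pi> permutes {1..n}"
  shows "(\<integral>\<omega>. wsup T n x (\<lambda>i. \<xi> (\<pi> i) \<omega>) \<partial>N) = gbar N n \<xi> T x"
proof -
  have "wsup T n x \<in> borel_measurable (Pi\<^sub>M {1..n} (\<lambda>_. borel))"
    using borel_measurable_wsup[of "\<lambda>i c. c i" "Pi\<^sub>M {1..n} (\<lambda>_. borel)"] by simp
  from integral_exchangeable(1)[OF exch assms \<xi> this]
  have "(\<integral>\<omega>. wsup T n x (\<lambda>i\<in>{1..n}. \<xi> (\<pi> i) \<omega>) \<partial>N) = (\<integral>\<omega>. wsup T n x (\<lambda>i\<in>{1..n}. \<xi> i \<omega>) \<partial>N)"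
    by simp
  moreover have "wsup T n x (restrict c {1..n}) = wsup T n x c" for c by (rule wsup_cong) auto
  ultimately show ?thesis unfolding gbar_eq by simp
qed

lemma integrable_wsup:
  assumes "\<And>i. i \<in> {1..n} \<Longrightarrow> u i \<in> borel_measurable N" "\<And>i. i \<in> {1..n} \<Longrightarrow> integrable N (u i)"
  shows "integrable N (\<lambda>\<omega>. wsup T n x (\<lambda>i. u i \<omega>))"
proof (rule Bochner_Integration.integrable_bound)
  show "integrable N (\<lambda>\<omega>. \<Sum>i=1..n. \<bar>u i \<omega>\<bar>)" using assms by auto
  show "AE \<omega> in N. norm (wsup T n x (\<lambda>i. u i \<omega>)) \<le> norm (\<Sum>i=1..n. \<bar>u i \<omega>\<bar>)"
    using abs_wsup_le by (auto intro: order_trans)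
qed (rule borel_measurable_wsup[OF assms(1)])

lemma integrable_weight: "i \<in> {1..n} \<Longrightarrow> integrable N (\<xi> i)"
  using integral_abs_weight(2) \<xi> integrable_abs_cancel by blast

lemma integrable_swap_mean: "i \<in> {1..n} \<Longrightarrow> j \<in> {1..n} \<Longrightarrow> integrable N (\<lambda>\<omega>. swap_mean n (\<lambda>j. \<xi> j \<omega>) i j)"
  unfolding swap_mean_def using integrable_weight by (cases "j = i") auto

lemma integrable_wsup_weights: "integrable N (\<lambda>\<omega>. wsup T n x (\<lambda>i. \<xi> i \<omega>))"
  using \<xi> integrable_weight by (rule integrable_wsup)

lemma integrable_wsup_swap_mean: "i \<in> {1..n} \<Longrightarrow> integrable N (\<lambda>\<omega>. wsup T n x (swap_mean n (\<lambda>j. \<xi> j \<omega>) i))"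
  using integrable_wsup[of "\<lambda>j \<omega>. swap_mean n (\<lambda>j. \<xi> j \<omega>) i j"] integrable_swap_mean by auto

lemma gbar_le: "gbar N n \<xi> T x \<le> n * \<kappa>"
proof -
  have "gbar N n \<xi> T x \<le> (\<integral>\<omega>. (\<Sum>i=1..n. \<bar>\<xi> i \<omega>\<bar>) \<partial>N)"
    unfolding gbar_eq
  proof (rule integral_mono[OF integrable_wsup_weights])
    show "wsup T n x (\<lambda>i. \<xi> i \<omega>) \<le> (\<Sum>i=1..n. \<bar>\<xi> i \<omega>\<bar>)" for \<omega>
      using abs_wsup_le[of "\<lambda>i. \<xi> i \<omega>"] by simp
  qed (use integral_abs_weight in auto)
  also have "\<dots> = n * \<kappa>" using integral_abs_weight by simp
  finally show ?thesis .
qed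

lemma gbar_swap_le_gbar:
  assumes i: "i \<in> {1..n}"
  shows "gbar_swap N n \<xi> T i x \<le> gbar N n \<xi> T x"
proof -
  have p: "Transposition.transpose i k permutes {1..n}" if "k \<in> {1..n}" for k
    using i that by (intro permutes_swap_id)
  have int: "integrable N (\<lambda>\<omega>. wsup T n x (\<lambda>j. \<xi> (Transposition.transpose i k j) \<omega>))" if "k \<in> {1..n}" for k
    using permutes_in_image[OF p[OF that]] by (intro integrable_wsup \<xi> integrable_weight) auto
  have "gbar_swap N n \<xi> T i x \<le> (\<integral>\<omega>. (\<Sum>k=1..n. wsup T n x (\<lambda>j. \<xi> (Transposition.transpose i k j) \<omega>)) / n \<partial>N)"
    unfolding gbar_swap_def
  proof (rule integral_mono_AE[OF integrable_wsup_swap_mean[OF i]])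
    show "AE \<omega> in N. wsup T n x (swap_mean n (\<lambda>j. \<xi> j \<omega>) i) \<le> (\<Sum>k=1..n. wsup T n x (\<lambda>j. \<xi> (Transposition.transpose i k j) \<omega>)) / n"
      using sum_0
    proof eventually_elim
      case (elim \<omega>)
      have "wsup T n x (swap_mean n (\<lambda>j. \<xi> j \<omega>) i) = wsup T n x (\<lambda>j. (\<Sum>k=1..n. \<xi> (Transposition.transpose i k j) \<omega>) / n)"
        using elim i by (intro wsup_cong swap_mean_eq_mean)
      also have "\<dots> \<le> (\<Sum>k=1..n. wsup T n x (\<lambda>j. \<xi> (Transposition.transpose i k j) \<omega>)) / n"
        by (rule wsup_mean_le) simp
      finally show ?case .
    qed
  qed (intro integrable_divide_zero Bochner_Integration.integrable_sum int)
  also have "\<dots> = (\<Sum>k=1..n. gbar N n \<xi> T x) / n"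
    using int by (simp add: integral_wsup_permuted[OF p])
  also have "\<dots> = gbar N n \<xi> T x" using n by simp
  finally show ?thesis .
qed

text \<open>\<open>wsup\<close> is 1-Lipschitz for the l1 distance of the weights. Removing entry i
  costs |\<xi> i|, of mean \<kappa>, and the correction at each j costs at most (|\<xi> i| + |\<xi>
  j|) / n, of total mean 2\<kappa>.\<close>

lemma gbar_le_gbar_swap:
  assumes i: "i \<in> {1..n}"
  shows "gbar N n \<xi> T x \<le> gbar_swap N n \<xi> T i x + 3 * \<kappa>"
proof -
  have int: "integrable N (\<lambda>\<omega>. (\<bar>\<xi> i \<omega>\<bar> + \<bar>\<xi> j \<omega>\<bar>) / n)" if "j \<in> {1..n}" for j
    by (intro integrable_divide_zero Bochner_Integration.integrable_add integral_abs_weight i that)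
  have isum: "integrable N (\<lambda>\<omega>. \<Sum>j=1..n. (\<bar>\<xi> i \<omega>\<bar> + \<bar>\<xi> j \<omega>\<bar>) / n)"
    by (rule Bochner_Integration.integrable_sum) (rule int)
  have "gbar N n \<xi> T x - gbar_swap N n \<xi> T i x = (\<integral>\<omega>. wsup T n x (\<lambda>i. \<xi> i \<omega>) - wsup T n x (swap_mean n (\<lambda>j. \<xi> j \<omega>) i) \<partial>N)"
    unfolding gbar_eq gbar_swap_def using integrable_wsup_weights integrable_wsup_swap_mean[OF i] by simp
  also have "\<dots> \<le> (\<integral>\<omega>. \<bar>\<xi> i \<omega>\<bar> + (\<Sum>j=1..n. (\<bar>\<xi> i \<omega>\<bar> + \<bar>\<xi> j \<omega>\<bar>) / n) \<partial>N)"
  proof (rule integral_mono)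
    fix \<omega>
    have "wsup T n x (\<lambda>i. \<xi> i \<omega>) - wsup T n x (swap_mean n (\<lambda>j. \<xi> j \<omega>) i) \<le> (\<Sum>j=1..n. \<bar>\<xi> j \<omega> - swap_mean n (\<lambda>j. \<xi> j \<omega>) i j\<bar>)"
      by (rule wsup_diff_le)
    also have "\<dots> \<le> (\<Sum>j=1..n. (if j = i then \<bar>\<xi> i \<omega>\<bar> else 0) + (\<bar>\<xi> i \<omega>\<bar> + \<bar>\<xi> j \<omega>\<bar>) / n)"
    proof (rule sum_mono)
      fix j
      have "\<bar>(\<xi> i \<omega> - \<xi> j \<omega>) / n\<bar> \<le> (\<bar>\<xi> i \<omega>\<bar> + \<bar>\<xi> j \<omega>\<bar>) / n"
        unfolding abs_divide by (auto intro!: divide_right_mono)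
      then show "\<bar>\<xi> j \<omega> - swap_mean n (\<lambda>j. \<xi> j \<omega>) i j\<bar> \<le> (if j = i then \<bar>\<xi> i \<omega>\<bar> else 0) + (\<bar>\<xi> i \<omega>\<bar> + \<bar>\<xi> j \<omega>\<bar>) / n"
        by (simp add: swap_mean_def)
    qed
    also have "\<dots> = \<bar>\<xi> i \<omega>\<bar> + (\<Sum>j=1..n. (\<bar>\<xi> i \<omega>\<bar> + \<bar>\<xi> j \<omega>\<bar>) / n)"
      using i by (simp add: sum.distrib)
    finally show "wsup T n x (\<lambda>i. \<xi> i \<omega>) - wsup T n x (swap_mean n (\<lambda>j. \<xi> j \<omega>) i) \<le> \<bar>\<xi> i \<omega>\<bar> + (\<Sum>j=1..n. (\<bar>\<xi> i \<omega>\<bar> + \<bar>\<xi> j \<omega>\<bar>) / n)" .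
  next
    show "integrable N (\<lambda>\<omega>. \<bar>\<xi> i \<omega>\<bar> + (\<Sum>j=1..n. (\<bar>\<xi> i \<omega>\<bar> + \<bar>\<xi> j \<omega>\<bar>) / n))"
      by (intro Bochner_Integration.integrable_add isum integral_abs_weight i)
  qed (use integrable_wsup_weights integrable_wsup_swap_mean[OF i] in auto)
  also have "\<dots> = \<kappa> + (\<Sum>j=1..n. \<integral>\<omega>. (\<bar>\<xi> i \<omega>\<bar> + \<bar>\<xi> j \<omega>\<bar>) / n \<partial>N)"
  proof -
    have "(\<Sum>j=1..n. \<integral>\<omega>. (\<bar>\<xi> i \<omega>\<bar> + \<bar>\<xi> j \<omega>\<bar>) / n \<partial>N) = (\<integral>\<omega>. (\<Sum>j=1..n. (\<bar>\<xi> i \<omega>\<bar> + \<bar>\<xi> j \<omega>\<bar>) / n) \<partial>N)"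
      by (rule Bochner_Integration.integral_sum[symmetric]) (rule int)
    then show ?thesis
      using Bochner_Integration.integral_add[OF integral_abs_weight(2)[OF i] isum] integral_abs_weight(1)[OF i]
      by linarith
  qed
  also have "\<dots> = \<kappa> + (\<Sum>j=1..n. (\<kappa> + \<kappa>) / n)"
    using integral_abs_weight i by (intro arg_cong2[of _ _ _ _ plus] sum.cong) auto
  also have "\<dots> = 3 * \<kappa>" using n by simp
  finally show ?thesis by simp
qed

lemma sum_gbar_gbar_swap_le:
  assumes n2: "n \<ge> 2"
  shows "(\<Sum>i=1..n. gbar N n \<xi> T x - gbar_swap N n \<xi> T i x) \<le> 2 * gbar N n \<xi> T x"
proof -
  have "(real n - 2) * gbar N n \<xi> T x = (\<integral>\<omega>. (real n - 2) * wsup T n x (\<lambda>i. \<xi> i \<omega>) \<partial>N)"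
    by (simp add: gbar_eq)
  also have "\<dots> \<le> (\<integral>\<omega>. (\<Sum>i=1..n. wsup T n x (swap_mean n (\<lambda>j. \<xi> j \<omega>) i)) \<partial>N)"
  proof (rule integral_mono_AE)
    show "AE \<omega> in N. (real n - 2) * wsup T n x (\<lambda>i. \<xi> i \<omega>) \<le> (\<Sum>i=1..n. wsup T n x (swap_mean n (\<lambda>j. \<xi> j \<omega>) i))"
      using sum_0
    proof eventually_elim
      case (elim \<omega>)
      let ?S = "\<Sum>i=1..n. wsup T n x (swap_mean n (\<lambda>j. \<xi> j \<omega>) i)"
      \<comment> \<open>All the swapped weights are tested on the same t, so
        \<open>sum_swap_mean\<close> applies entry by entry before any supremum is taken.\<close>
      have *: "(real n - 2) * (\<Sum>j=1..n. \<xi> j \<omega> * t (x j)) \<le> ?S" if t: "t \<in> T" for t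
      proof -
        have "(real n - 2) * (\<Sum>j=1..n. \<xi> j \<omega> * t (x j)) = (\<Sum>j=1..n. (\<Sum>i=1..n. swap_mean n (\<lambda>j. \<xi> j \<omega>) i j) * t (x j))"
          unfolding sum_distrib_left using elim by (intro sum.cong) (auto simp: sum_swap_mean)
        also have "\<dots> = (\<Sum>i=1..n. \<Sum>j=1..n. swap_mean n (\<lambda>j. \<xi> j \<omega>) i j * t (x j))"
          unfolding sum_distrib_right by (rule sum.swap)
        also have "\<dots> \<le> ?S" by (intro sum_mono wsup_upper t)
        finally show ?thesis .
      qed
      show ?case
      \<comment> \<open>For n = 2 the factor is 0 and cannot be divided out, but any single t
        already shows that the right side is nonnegative.\<close>
      proof (cases "n = 2")
        case True
        then show ?thesis using * T_nonempty by auto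
      next
        case False
        then have n3: "0 < real n - 2" using n2 by linarith
        have "wsup T n x (\<lambda>i. \<xi> i \<omega>) \<le> ?S / (real n - 2)"
          using * n3 by (intro wsup_least) (simp add: pos_le_divide_eq mult.commute)
        then show ?thesis using n3 by (simp add: pos_le_divide_eq mult.commute)
      qed
    qed
  qed (use integrable_wsup_weights integrable_wsup_swap_mean in auto)
  also have "\<dots> = (\<Sum>i=1..n. gbar_swap N n \<xi> T i x)"
    unfolding gbar_swap_def using integrable_wsup_swap_mean by (intro Bochner_Integration.integral_sum) auto
  finally show ?thesis by (simp add: sum_subtractf algebra_simps)
qed

lemma weight_0: "n = 1 \<Longrightarrow> \<kappa> = 0"
proof -
  assume "n = 1"
  then have "AE \<omega> in N. \<xi> 1 \<omega> = 0" using sum_0 by simp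
  then have "(\<integral>\<omega>. \<bar>\<xi> 1 \<omega>\<bar> \<partial>N) = (\<integral>\<omega>. 0 \<partial>N)"
    using \<xi>[of 1] n by (intro integral_cong_AE) auto
  then show ?thesis using \<kappa> by simp
qed

text \<open>The increments over \<open>gbar_swap\<close> are nonnegative and add up to at most 2
  \<open>gbar\<close>. For n = 1 the only swapped weight is 0, so \<open>gbar_swap\<close> is
  0.\<close>

lemma gbar_nonneg: "0 \<le> gbar N n \<xi> T x"
proof (cases "n = 1")
  case True
  then show ?thesis using gbar_swap_le_gbar[of 1] by (simp add: gbar_swap_def wsup_def swap_mean_def T_nonempty)
next
  case False
  have "0 \<le> (\<Sum>i=1..n. gbar N n \<xi> T x - gbar_swap N n \<xi> T i x)"
    using gbar_swap_le_gbar by (intro sum_nonneg) simp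
  then show ?thesis using sum_gbar_gbar_swap_le False n by simp
qed

end

section \<open>The concentration inequalities\<close>

theorem theorem1:
  fixes N :: "'w measure" and M :: "'a measure" and E :: "'e measure"
    and n :: nat and \<xi> :: "nat \<Rightarrow> 'w \<Rightarrow> real" and \<kappa> :: real
    and T :: "('e \<Rightarrow> real) set" and X :: "nat \<Rightarrow> 'a \<Rightarrow> 'e"
  assumes "n \<ge> 1"
    and "prob_space N"
    and "\<And>i. i \<in> {1..n} \<Longrightarrow> \<xi> i \<in> borel_measurable N"
    and "exchangeable N n \<xi>"
    and "integrable N (\<lambda>\<omega>. \<bar>\<xi> 1 \<omega>\<bar>)"
    and "\<kappa> = (\<integral>\<omega>. \<bar>\<xi> 1 \<omega>\<bar> \<partial>N)"
    and "AE \<omega> in N. (\<Sum>i=1..n. \<xi> i \<omega>) = 0"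
    and "T \<noteq> {}"
    and "\<And>t. t \<in> T \<Longrightarrow> t \<in> borel_measurable E"
    and "\<And>t y. t \<in> T \<Longrightarrow> y \<in> space E \<Longrightarrow> t y \<in> {-1..1}"
    and "prob_space M"
    and "prob_space.indep_vars M (\<lambda>_. E) X {1..n}"
    and "(\<lambda>\<omega>. gbar N n \<xi> T (\<lambda>i. X i \<omega>)) \<in> borel_measurable M"
    and "gbar N n \<xi> T \<in> borel_measurable (completion (joint_law M E n X))"
  shows "\<forall>x::real. x > 0 \<longrightarrow>
    measure M {\<omega> \<in> space M. gbar N n \<xi> T (\<lambda>i. X i \<omega>)
        \<le> (\<integral>\<omega>'. gbar N n \<xi> T (\<lambda>i. X i \<omega>') \<partial>M)
          + sqrt (12 * \<kappa> * x * (\<integral>\<omega>'. gbar N n \<xi> T (\<lambda>i. X i \<omega>') \<partial>M))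
          + 5 * \<kappa> * x} \<ge> 1 - exp (- x)
    \<and> measure M {\<omega> \<in> space M. gbar N n \<xi> T (\<lambda>i. X i \<omega>)
        \<ge> (\<integral>\<omega>'. gbar N n \<xi> T (\<lambda>i. X i \<omega>') \<partial>M)
          - sqrt (12 * \<kappa> * x * (\<integral>\<omega>'. gbar N n \<xi> T (\<lambda>i. X i \<omega>') \<partial>M))}
      \<ge> 1 - exp (- x)"
proof (intro allI impI)
  fix x :: real assume x: "0 < x"
  interpret M: prob_space M by fact
  define Z where "Z \<omega> = gbar N n \<xi> T (\<lambda>i. X i \<omega>)" for \<omega>
  define \<mu> where "\<mu> = (\<integral>\<omega>. Z \<omega> \<partial>M)"
  have Z[measurable]: "Z \<in> borel_measurable M" using assms(13) unfolding Z_def .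
  have X: "X i \<in> M \<rightarrow>\<^sub>M E" if "i \<in> {1..n}" for i
    using assms(12) that unfolding M.indep_vars_def by blast
  have weights: "exchangeable_weights N T n y \<xi> \<kappa>" if "\<And>i. i \<in> {1..n} \<Longrightarrow> y i \<in> space E" for y
  proof -
    have "\<bar>t (y i)\<bar> \<le> 1" if "t \<in> T" "i \<in> {1..n}" for t i
      using assms(10)[OF that(1), of "y i"] \<open>\<And>i. i \<in> {1..n} \<Longrightarrow> y i \<in> space E\<close> that(2) by auto
    then show ?thesis
      using assms(1-8) by (simp add: exchangeable_weights_def exchangeable_weights_axioms_def bounded_functions_def)
  qed
  have \<kappa>0: "0 \<le> \<kappa>" using assms(6) by simp
  have "M.prob {\<omega> \<in> space M. Z \<omega> \<le> \<mu> + sqrt (12 * \<kappa> * x * \<mu>) + 5 * \<kappa> * x} \<ge> 1 - exp (- x) \<and>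
    M.prob {\<omega> \<in> space M. Z \<omega> \<ge> \<mu> - sqrt (12 * \<kappa> * x * \<mu>)} \<ge> 1 - exp (- x)"
  \<comment> \<open>The rescaling by 3\<kappa> is impossible for \<kappa> = 0, but then 0 \<le>
    \<open>gbar\<close> \<le> n \<kappa> forces Z = 0.\<close>
  proof (cases "\<kappa> = 0")
    case True
    have Z0: "Z \<omega> = 0" if "\<omega> \<in> space M" for \<omega>
    proof -
      interpret exchangeable_weights N T n "\<lambda>i. X i \<omega>" \<xi> \<kappa>
        using measurable_space[OF X that] by (intro weights)
      show ?thesis using gbar_nonneg gbar_le True by (simp add: Z_def)
    qed
    have "\<mu> = (\<integral>\<omega>. 0 \<partial>M)"
      unfolding \<mu>_def using Z0 by (intro Bochner_Integration.integral_cong) auto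
    then have "\<mu> = 0" by simp
    have "{\<omega> \<in> space M. Z \<omega> \<le> \<mu> + sqrt (12 * \<kappa> * x * \<mu>) + 5 * \<kappa> * x} = space M"
      "{\<omega> \<in> space M. Z \<omega> \<ge> \<mu> - sqrt (12 * \<kappa> * x * \<mu>)} = space M"
      using Z0 True \<open>\<mu> = 0\<close> by auto
    then show ?thesis by (simp add: M.prob_space)
  next
    case False
    then have \<kappa>_pos: "0 < \<kappa>" using \<kappa>0 by simp
    have n2: "2 \<le> n"
    proof (rule ccontr)
      assume "\<not> 2 \<le> n"
      then have "n = 1" using assms(1) by simp
      obtain \<omega> where "\<omega> \<in> space M" using M.not_empty by blast
      then interpret exchangeable_weights N T n "\<lambda>i. X i \<omega>" \<xi> \<kappa>
        using measurable_space[OF X] by (intro weights)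
      show False using weight_0[OF \<open>n = 1\<close>] False by simp
    qed
    define P where "P i = distr M E (X i)" for i
    define Q where "Q = Pi\<^sub>M {1..n} P"
    \<comment> \<open>Points of the product space are extensional functions, hence the restriction;
      \<open>gbar\<close> reads only the entries in 1..n.\<close>
    define Xr where "Xr \<omega> = (\<lambda>i\<in>{1..n}. X i \<omega>)" for \<omega>
    have P: "prob_space (P i)" if "i \<in> {1..n}" for i
      unfolding P_def using X[OF that] by (intro M.prob_space_distr)
    have sQ: "sets Q = sets (Pi\<^sub>M {1..n} (\<lambda>_. E))"
      unfolding Q_def by (intro sets_PiM_cong) (auto simp: P_def)
    have Xr[measurable]: "Xr \<in> M \<rightarrow>\<^sub>M Q"
      unfolding measurable_cong_sets[OF refl sQ] Xr_def using X by (intro measurable_restrict)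
    have Q: "distr M Q Xr = Q" "joint_law M E n X = Q"
    proof -
      have *: "distr M (Pi\<^sub>M {1..n} (\<lambda>_. E)) Xr = Q"
        using M.indep_vars_iff_distr_eq_PiM'[of "{1..n}" X "\<lambda>_. E"] assms(1,12) X
        unfolding Q_def P_def Xr_def by auto
      then show "joint_law M E n X = Q" unfolding joint_law_def Xr_def .
      have "distr M Q Xr = distr M (Pi\<^sub>M {1..n} (\<lambda>_. E)) Xr"
        by (rule distr_cong[OF refl sQ refl])
      then show "distr M Q Xr = Q" using * by (rule trans)
    qed
    interpret Q: prob_space Q unfolding Q_def by (intro prob_space_PiM P)
    have weights_Q: "exchangeable_weights N T n y \<xi> \<kappa>" if "y \<in> space Q" for y
      using that unfolding sets_eq_imp_space_eq[OF sQ] space_PiM by (intro weights) auto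
    obtain g' where g'[measurable]: "g' \<in> borel_measurable Q" "AE y in Q. gbar N n \<xi> T y = g' y"
      using completion_ex_borel_measurable_real[OF assms(14)] unfolding Q by blast
    \<comment> \<open>Clipping the Borel modification makes the bounds hold everywhere. By
      \<open>gbar_nonneg\<close> and \<open>gbar_le\<close> it changes nothing almost everywhere; n
      / 3 is n \<kappa> / (3\<kappa>).\<close>
    define f where "f y = max 0 (min (n / 3) (g' y / (3 * \<kappa>)))" for y
    define h where "h i y = gbar_swap N n \<xi> T i y / (3 * \<kappa>)" for i y
    have f[measurable]: "f \<in> borel_measurable Q" unfolding f_def by measurable
    have f_eq: "AE y in Q. f y = gbar N n \<xi> T y / (3 * \<kappa>)"
      using g'(2) AE_space
    proof eventually_elim
      case (elim y)
      interpret exchangeable_weights N T n y \<xi> \<kappa> by (rule weights_Q[OF elim(2)])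
      have "gbar N n \<xi> T y / (3 * \<kappa>) \<le> n / 3" "0 \<le> gbar N n \<xi> T y / (3 * \<kappa>)"
        using gbar_le gbar_nonneg \<kappa>_pos by (auto simp: field_simps)
      then show ?case unfolding f_def elim(1)[symmetric] by simp
    qed
    interpret self_bounding "{1..n}" P f h 2 "n / 3"
    proof (rule self_bounding.intro)
      show "AE y in Pi\<^sub>M {1..n} P. \<forall>i\<in>{1..n}. h i y \<le> f y \<and> f y \<le> h i y + 1"
        unfolding Q_def[symmetric] using f_eq AE_space
      proof eventually_elim
        case (elim y)
        interpret exchangeable_weights N T n y \<xi> \<kappa> by (rule weights_Q[OF elim(2)])
        show ?case
        proof
          fix i assume i: "i \<in> {1..n}"
          show "h i y \<le> f y \<and> f y \<le> h i y + 1"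
            unfolding elim h_def using gbar_swap_le_gbar[OF i] gbar_le_gbar_swap[OF i] \<kappa>_pos by (simp add: field_simps)
        qed
      qed
      show "AE y in Pi\<^sub>M {1..n} P. (\<Sum>i\<in>{1..n}. f y - h i y) \<le> 2 * f y"
        unfolding Q_def[symmetric] using f_eq AE_space
      proof eventually_elim
        case (elim y)
        interpret exchangeable_weights N T n y \<xi> \<kappa> by (rule weights_Q[OF elim(2)])
        have "(\<Sum>i\<in>{1..n}. f y - h i y) = (\<Sum>i=1..n. gbar N n \<xi> T y - gbar_swap N n \<xi> T i y) / (3 * \<kappa>)"
          unfolding elim h_def by (simp add: sum_divide_distrib diff_divide_distrib)
        also have "\<dots> \<le> 2 * gbar N n \<xi> T y / (3 * \<kappa>)"
          using sum_gbar_gbar_swap_le[OF n2] \<kappa>_pos by (intro divide_right_mono) auto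
        finally show ?case unfolding elim by simp
      qed
      show "h i (y(i := z)) = h i y" for i y z by (simp add: h_def gbar_swap_upd)
      show "f \<in> borel_measurable (Pi\<^sub>M {1..n} P)" using f unfolding Q_def .
      show "0 \<le> f y" "f y \<le> n / 3" for y by (simp_all add: f_def)
      show "prob_space (P i)" if "i \<in> {1..n}" for i by (rule P[OF that])
    qed simp
    interpret exp_entropy_bound Q f 2 "n / 3"
    proof
      show "fun_entropy Q (\<lambda>y. exp (l * f y)) \<le> 2 * phi (- l) * (\<integral>y. f y * exp (l * f y) \<partial>Q)" for l
        unfolding Q_def by (rule fun_entropy_exp_self_bounding)
    qed (use f f_nonneg f_le in auto)
    have ZXr: "Z \<omega> = gbar N n \<xi> T (Xr \<omega>)" for \<omega>
    proof -
      have "(\<Sum>i=1..n. \<xi> i w * t (X i \<omega>)) = (\<Sum>i=1..n. \<xi> i w * t (Xr \<omega> i))" for w t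
        by (intro sum.cong) (auto simp: Xr_def)
      then show ?thesis unfolding Z_def gbar_def by simp
    qed
    have Z_eq: "AE \<omega> in M. Z \<omega> = 3 * \<kappa> * f (Xr \<omega>)"
    proof -
      have "AE y in distr M Q Xr. f y = gbar N n \<xi> T y / (3 * \<kappa>)" using f_eq unfolding Q(1) .
      from AE_distrD[OF Xr this] show ?thesis
        by eventually_elim (use \<kappa>_pos in \<open>simp add: ZXr\<close>)
    qed
    have \<mu>: "\<mu> = 3 * \<kappa> * v"
    proof -
      have "\<mu> = (\<integral>\<omega>. 3 * \<kappa> * f (Xr \<omega>) \<partial>M)"
        unfolding \<mu>_def using Z_eq by (intro integral_cong_AE) auto
      also have "\<dots> = 3 * \<kappa> * (\<integral>y. f y \<partial>distr M Q Xr)" by (simp add: integral_distr[OF Xr f])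
      finally show ?thesis using Q(1) by simp
    qed
    have transfer: "M.prob {\<omega> \<in> space M. R (f (Xr \<omega>))} = Q.prob {y \<in> space Q. R (f y)}"
      if [measurable]: "Measurable.pred borel R" for R
    proof -
      have "Q.prob {y \<in> space Q. R (f y)} = measure (distr M Q Xr) {y \<in> space Q. R (f y)}"
        using Q(1) by simp
      also have "\<dots> = M.prob (Xr -` {y \<in> space Q. R (f y)} \<inter> space M)"
        by (rule measure_distr[OF Xr]) simp
      also have "Xr -` {y \<in> space Q. R (f y)} \<inter> space M = {\<omega> \<in> space M. R (f (Xr \<omega>))}"
        using measurable_space[OF Xr] by auto
      finally show ?thesis by simp
    qed
    define s where "s = sqrt (2 * 2 * v * x)"
    have sq: "sqrt (12 * \<kappa> * x * \<mu>) = 3 * \<kappa> * s"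
    proof -
      \<comment> \<open>Scaling back: (3\<kappa>)^2 * 4 v x = 12 \<kappa> x (3 \<kappa> v), and
        \<mu> = 3 \<kappa> v.\<close>
      have "12 * \<kappa> * x * \<mu> = (3 * \<kappa>)^2 * (2 * 2 * v * x)"
        unfolding \<mu> by (simp add: power2_eq_square)
      then have "sqrt (12 * \<kappa> * x * \<mu>) = sqrt ((3 * \<kappa>)^2) * s"
        by (simp only: s_def real_sqrt_mult)
      also have "sqrt ((3 * \<kappa>)^2) = 3 * \<kappa>"
        unfolding real_sqrt_abs using \<kappa>_pos by simp
      finally show ?thesis .
    qed
    have "M.prob {\<omega> \<in> space M. \<not> Z \<omega> \<le> \<mu> + sqrt (12 * \<kappa> * x * \<mu>) + 5 * \<kappa> * x}
      \<le> M.prob {\<omega> \<in> space M. v + s + 2 / 2 * x < f (Xr \<omega>)}"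
    proof (rule M.finite_measure_mono_AE)
      show "AE \<omega> in M. \<omega> \<in> {\<omega> \<in> space M. \<not> Z \<omega> \<le> \<mu> + sqrt (12 * \<kappa> * x * \<mu>) + 5 * \<kappa> * x} \<longrightarrow>
         \<omega> \<in> {\<omega> \<in> space M. v + s + 2 / 2 * x < f (Xr \<omega>)}"
        using Z_eq
      proof eventually_elim
        case (elim \<omega>)
        \<comment> \<open>The linear term obtained is 3 \<kappa> x, within the claimed 5 \<kappa>
          x.\<close>
        have "3 * \<kappa> * (v + s + 2 / 2 * x) \<le> \<mu> + sqrt (12 * \<kappa> * x * \<mu>) + 5 * \<kappa> * x"
          unfolding sq unfolding \<mu> using \<kappa>_pos x by (simp add: algebra_simps)
        then have "3 * \<kappa> * (v + s + 2 / 2 * x) < 3 * \<kappa> * f (Xr \<omega>)"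
          if "\<not> Z \<omega> \<le> \<mu> + sqrt (12 * \<kappa> * x * \<mu>) + 5 * \<kappa> * x"
          using that elim by linarith
        then show ?case using \<kappa>_pos by simp
      qed
    qed auto
    also have "\<dots> \<le> exp (- x)"
      using upper_tail[OF x] by (subst transfer) (auto simp: s_def)
    finally have 1: "M.prob {\<omega> \<in> space M. \<not> Z \<omega> \<le> \<mu> + sqrt (12 * \<kappa> * x * \<mu>) + 5 * \<kappa> * x} \<le> exp (- x)" .
    have "M.prob {\<omega> \<in> space M. \<not> Z \<omega> \<ge> \<mu> - sqrt (12 * \<kappa> * x * \<mu>)}
      \<le> M.prob {\<omega> \<in> space M. f (Xr \<omega>) < v - s}"
    proof (rule M.finite_measure_mono_AE)
      show "AE \<omega> in M. \<omega> \<in> {\<omega> \<in> space M. \<not> Z \<omega> \<ge> \<mu> - sqrt (12 * \<kappa> * x * \<mu>)} \<longrightarrow>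
         \<omega> \<in> {\<omega> \<in> space M. f (Xr \<omega>) < v - s}"
        using Z_eq
      proof eventually_elim
        case (elim \<omega>)
        have "3 * \<kappa> * (v - s) = \<mu> - sqrt (12 * \<kappa> * x * \<mu>)"
          unfolding sq unfolding \<mu> by (simp add: algebra_simps)
        then have "3 * \<kappa> * f (Xr \<omega>) < 3 * \<kappa> * (v - s)"
          if "\<not> Z \<omega> \<ge> \<mu> - sqrt (12 * \<kappa> * x * \<mu>)"
          using that elim by linarith
        then show ?case using \<kappa>_pos by simp
      qed
    qed auto
    also have "\<dots> \<le> exp (- x)"
      using lower_tail[OF x] by (subst transfer) (auto simp: s_def)
    finally have 2: "M.prob {\<omega> \<in> space M. \<not> Z \<omega> \<ge> \<mu> - sqrt (12 * \<kappa> * x * \<mu>)} \<le> exp (- x)" .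
    have "M.prob {\<omega> \<in> space M. \<not> Z \<omega> \<le> \<mu> + sqrt (12 * \<kappa> * x * \<mu>) + 5 * \<kappa> * x} =
      1 - M.prob {\<omega> \<in> space M. Z \<omega> \<le> \<mu> + sqrt (12 * \<kappa> * x * \<mu>) + 5 * \<kappa> * x}"
      by (rule M.prob_neg) measurable
    moreover have "M.prob {\<omega> \<in> space M. \<not> Z \<omega> \<ge> \<mu> - sqrt (12 * \<kappa> * x * \<mu>)} =
      1 - M.prob {\<omega> \<in> space M. Z \<omega> \<ge> \<mu> - sqrt (12 * \<kappa> * x * \<mu>)}"
      by (rule M.prob_neg) measurable
    ultimately show ?thesis using 1 2 by linarith
  qed
  then show "measure M {\<omega> \<in> space M. gbar N n \<xi> T (\<lambda>i. X i \<omega>)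
        \<le> (\<integral>\<omega>'. gbar N n \<xi> T (\<lambda>i. X i \<omega>') \<partial>M)
          + sqrt (12 * \<kappa> * x * (\<integral>\<omega>'. gbar N n \<xi> T (\<lambda>i. X i \<omega>') \<partial>M))
          + 5 * \<kappa> * x} \<ge> 1 - exp (- x)
    \<and> measure M {\<omega> \<in> space M. gbar N n \<xi> T (\<lambda>i. X i \<omega>)
        \<ge> (\<integral>\<omega>'. gbar N n \<xi> T (\<lambda>i. X i \<omega>') \<partial>M)
          - sqrt (12 * \<kappa> * x * (\<integral>\<omega>'. gbar N n \<xi> T (\<lambda>i. X i \<omega>') \<partial>M))}
      \<ge> 1 - exp (- x)"
    unfolding \<mu>_def Z_def .
qed

end
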